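(* Let $R=\mathbb{Z}_2[x,y,x^{-1},y^{-1}]$ and let $f,g\in R$ satisfy the topological order condition. Let $I=\langle f,g\rangle\subset R$ be the ideal generated by $f$ and $g$. Then the maximal logical dimension $k_{\max}$ of the stabilizer code defined by $f$ and $g$, i.e. the maximum of $k(\alpha,\beta,\gamma)$ over all tori (all $\alpha,\beta\in\mathbb{Z}_{\ge 1}$, $\gamma\in\mathbb{Z}$), is $$k_{\max}=2\,\dim_{\mathbb{Z}_2}\left(\frac{\mathbb{Z}_2[x,y,x^{-1},y^{-1}]}{\langle f(x,y),\,g(x,y)\rangle}\right).$$
   Context: The code. $R=\mathbb{Z}_2[x,y,x^{-1},y^{-1}]$ is the Laurent polynomial ring over the field with two elements. For $p\in R$, $\overline{p}$ is the image of $p$ under the $\mathbb{Z}_2$-linear antipode map $x^ny^m\mapsto x^{-n}y^{-m}$. On the square lattice with two qubits per unit cell (cells indexed by $\mathbb{Z}^2$), Pauli operators of pure $X$-type (or pure $Z$-type) are encoded as elements of $R^2$, the coefficient of $x^ny^m$ in the $i$-th component indicating whether the operator acts on the $i$-th qubit of cell $(n,m)$. Given $f,g\in R$, the translation-invariant CSS stabilizer code defined by $f,g$ has $X$-stabilizer generators all $x^ny^m\,(f,g)$ and $Z$-stabilizer generators all $x^ny^m\,(\overline{g},\overline{f})$, $n,m\in\mathbb{Z}$. Torus. For integers $\alpha,\beta\ge 1$ and $\gamma\in\mathbb{Z}$, the (twisted) torus with lattice vectors $\vec a_1=(0,\alpha)$, $\vec a_2=(\beta,\gamma)$ is obtained by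 identifying cells that differ by an element of the lattice generated by $\vec a_1,\vec a_2$; algebraically $R$ is replaced by $S=R/\langle y^\alpha-1,\;x^\beta y^\gamma-1\rangle$, of $\mathbb{Z}_2$-dimension $\alpha\beta$. (Every torus, i.e. every finite-index sublattice of $\mathbb{Z}^2$, is of this form; the untwisted $L_x\times L_y$ torus is $\beta=L_x,\alpha=L_y,\gamma=0$.) The code on this torus has $n=2\alpha\beta$ physical qubits. Logical dimension. $k(\alpha,\beta,\gamma)=n-\dim_{\mathbb{Z}_2}\{(sf,sg):s\in S\}-\dim_{\mathbb{Z}_2}\{(s\overline{g},s\overline{f}):s\in S\}$ (subspaces of $S^2$), i.e. $n-\operatorname{rank}H_X-\operatorname{rank}H_Z$ for the parity-check matrices of the $X$- and $Z$-stabilizers. Topological order condition. On the infinite plane, every finitely supported Pauli operator commuting with all stabilizers is a finite product of stabilizers; equivalently, $f$ and $g$ are coprime in $R$ (every common divisor is a unit of $R$). *)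

theory Defs
  imports
    "HOL-Library.Z2"
    "HOL-Library.Poly_Mapping"
    "HOL-Library.Product_Plus"
    "HOL-Algebra.Embedded_Algebras"
    "HOL-Algebra.QuotRing"
    "HOL-Algebra.Chinese_Remainder"
    "HOL-Decision_Procs.Algebra_Aux"
begin

section \<open>Laurent polynomials over the field with two elements\<close>

text \<open>
  The ring \<open>\<int>\<^sub>2[x, y, x\<^sup>-\<^sup>1, y\<^sup>-\<^sup>1]\<close> is the group algebra of \<open>\<int> \<times> \<int>\<close>: finitely supported
  coefficient functions, multiplied by convolution.
\<close>

type_synonym laurent = "(int \<times> int) \<Rightarrow>\<^sub>0 bit"

definition xy :: "int \<Rightarrow> int \<Rightarrow> laurent"  \<comment> \<open>\<open>x\<^sup>n y\<^sup>m\<close>\<close>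
  where "xy n m = Poly_Mapping.single (n, m) 1"

definition antipode :: "laurent \<Rightarrow> laurent"
  where "antipode p = Poly_Mapping.map_key uminus p"

text \<open>The same ring as a record, so that ideals and quotients can be formed.\<close>

abbreviation laurent_ring :: "laurent ring"
  where "laurent_ring \<equiv> cring_class_ops"

section \<open>The code on the infinite plane\<close>

text \<open>
  A finitely supported Pauli operator, up to phase, is a pair of its \<open>X\<close>-part and its \<open>Z\<close>-part,
  each a pair of Laurent polynomials (one for each qubit of the unit cell). The product of
  operators is addition.
\<close>

type_synonym pauli = "(laurent \<times> laurent) \<times> (laurent \<times> laurent)"

text \<open>
  Parity of the number of cells in both supports. Here the coefficients are paired cell by cell;
  this is not the product of Laurent polynomials.
\<close>

definition overlap :: "laurent \<Rightarrow> laurent \<Rightarrow> bit"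
  where "overlap p q =
    (\<Sum>c \<in> Poly_Mapping.keys p. Poly_Mapping.lookup p c * Poly_Mapping.lookup q c)"

fun commute :: "pauli \<Rightarrow> pauli \<Rightarrow> bool"
  where "commute ((a1, a2), (b1, b2)) ((c1, c2), (d1, d2)) \<longleftrightarrow>
    overlap a1 d1 + overlap a2 d2 + overlap b1 c1 + overlap b2 c2 = 0"

definition stabilizer_generators :: "laurent \<Rightarrow> laurent \<Rightarrow> pauli set"
  where "stabilizer_generators f g =
    {((xy n m * f, xy n m * g), (0, 0)) | n m. True} \<union>
    {((0, 0), (xy n m * antipode g, xy n m * antipode f)) | n m. True}"

text \<open>
  Commuting with all stabilizers is the same as commuting with the generators. Every Pauli
  operator squares to the identity up to phase, so a finite product of generators is the sum of
  a finite set of generators.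
\<close>

definition topological_order :: "laurent \<Rightarrow> laurent \<Rightarrow> bool"
  where "topological_order f g \<longleftrightarrow>
    (\<forall>P. (\<forall>Q \<in> stabilizer_generators f g. commute P Q) \<longrightarrow>
      (\<exists>A. finite A \<and> A \<subseteq> stabilizer_generators f g \<and> P = (\<Sum>Q\<in>A. Q)))"

section \<open>Dimension over the prime field\<close>

text \<open>
  The dimensions below are taken in rings of characteristic two, where \<open>{\<zero>, \<one>}\<close> is the copy of
  \<open>\<int>\<^sub>2\<close>. In the zero ring that set is \<open>{\<zero>}\<close>, and the dimension of the ring is \<open>0\<close>.
\<close>

definition fin_dim2 :: "('a, 'b) ring_scheme \<Rightarrow> 'a set \<Rightarrow> bool"
  where "fin_dim2 A E \<longleftrightarrow> ring.finite_dimension A {\<zero>\<^bsub>A\<^esub>, \<one>\<^bsub>A\<^esub>} E"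

definition dim2 :: "('a, 'b) ring_scheme \<Rightarrow> 'a set \<Rightarrow> nat"
  where "dim2 A E = ring.dim A {\<zero>\<^bsub>A\<^esub>, \<one>\<^bsub>A\<^esub>} E"

section \<open>The code on a torus\<close>

definition torus_ideal :: "nat \<Rightarrow> nat \<Rightarrow> int \<Rightarrow> laurent set"
  where "torus_ideal \<alpha> \<beta> \<gamma> = Idl\<^bsub>laurent_ring\<^esub> {xy 0 (int \<alpha>) - 1, xy (int \<beta>) \<gamma> - 1}"

definition torus_ring :: "nat \<Rightarrow> nat \<Rightarrow> int \<Rightarrow> laurent set ring"
  where "torus_ring \<alpha> \<beta> \<gamma> = laurent_ring Quot torus_ideal \<alpha> \<beta> \<gamma>"

text \<open>The subspace \<open>{(s p, s q) : s \<in> S}\<close> of \<open>S\<^sup>2\<close>, for \<open>p\<close> and \<open>q\<close> mapped to the torus ring \<open>S\<close>.\<close>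

definition stabilizer_space ::
    "nat \<Rightarrow> nat \<Rightarrow> int \<Rightarrow> laurent \<Rightarrow> laurent \<Rightarrow> (laurent set \<times> laurent set) set"
  where "stabilizer_space \<alpha> \<beta> \<gamma> p q =
    {(s \<otimes>\<^bsub>torus_ring \<alpha> \<beta> \<gamma>\<^esub> (torus_ideal \<alpha> \<beta> \<gamma> +>\<^bsub>laurent_ring\<^esub> p),
      s \<otimes>\<^bsub>torus_ring \<alpha> \<beta> \<gamma>\<^esub> (torus_ideal \<alpha> \<beta> \<gamma> +>\<^bsub>laurent_ring\<^esub> q)) | s.
      s \<in> carrier (torus_ring \<alpha> \<beta> \<gamma>)}"

text \<open>The value is an integer so that the subtraction is not truncated.\<close>

definition logical_dim :: "laurent \<Rightarrow> laurent \<Rightarrow> nat \<Rightarrow> nat \<Rightarrow> int \<Rightarrow> int"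
  where "logical_dim f g \<alpha> \<beta> \<gamma> =
    (let S2 = RDirProd (torus_ring \<alpha> \<beta> \<gamma>) (torus_ring \<alpha> \<beta> \<gamma>) in
      2 * int \<alpha> * int \<beta>
      - int (dim2 S2 (stabilizer_space \<alpha> \<beta> \<gamma> f g))
      - int (dim2 S2 (stabilizer_space \<alpha> \<beta> \<gamma> (antipode g) (antipode f))))"

definition is_max_logical_dim :: "laurent \<Rightarrow> laurent \<Rightarrow> int \<Rightarrow> bool"
  where "is_max_logical_dim f g k \<longleftrightarrow>
    (\<exists>\<alpha> \<beta> \<gamma>. \<alpha> \<ge> 1 \<and> \<beta> \<ge> 1 \<and> logical_dim f g \<alpha> \<beta> \<gamma> = k) \<and>
    (\<forall>\<alpha> \<beta> \<gamma>. \<alpha> \<ge> 1 \<longrightarrow> \<beta> \<ge> 1 \<longrightarrow> logical_dim f g \<alpha> \<beta> \<gamma> \<le> k)"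

end

theory Submission
  imports Defs
begin

text \<open>
  All dimensions are read off from cardinalities. The topological order condition says that
  \<open>a g = b f\<close> forces \<open>(a, b) = (s f, s g)\<close>. Comparing the number of pairs \<open>(p, q)\<close> supported in suitable
  rectangles with the number of values of \<open>p f + q g\<close> then bounds the number of residue classes modulo
  \<open>I = \<langle>f, g\<rangle>\<close>, as in Bernstein's theorem, so \<open>R / I\<close> is finite.

  The torus ring \<open>S = R / T\<close> is a finite group algebra, hence a Frobenius algebra: the annihilator of
  an ideal \<open>J\<close> of \<open>S\<close> has dimension \<open>dim S - dim J\<close>. Applied to the ideal generated by \<open>f, g\<close>, and
  transported along the antipode, this gives \<open>k = 2 dim (R / (T + I)) \<le> 2 dim (R / I)\<close>. In the finite
  ring \<open>R / I\<close> the units \<open>x, y\<close> have finite orders \<open>\<beta>, \<alpha>\<close>, and the untwisted torus of these sizes has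
  \<open>T \<subseteq> I\<close>, so the bound is attained.
\<close>

section \<open>Dimension and cardinality\<close>

lemma (in ring) line_extension_prime_field:
  assumes "v \<in> carrier R" "E \<subseteq> carrier R"
  shows "line_extension {\<zero>, \<one>} v E = E \<union> (\<lambda>e. v \<oplus> e) ` E"
  using assms by (auto simp: line_extension_def set_add_def' r_coset_def subset_iff image_iff)

text \<open>Each \<open>Suc_dim\<close> step doubles the size: over the scalars
  \<open>{\<zero>, \<one>}\<close> it adjoins the single coset \<open>v \<oplus> E\<close>, which
  misses \<open>E\<close> because \<open>v\<close> lies outside. Closure under addition is carried
  along, as disjointness depends on it.\<close>

lemma (in ring) card_of_dimension:
  assumes "\<one> \<oplus> \<one> = \<zero>" "dimension n {\<zero>, \<one>} E"
  shows "E \<subseteq> carrier R \<and> finite E \<and> card E = 2 ^ n \<and> \<zero> \<in> E \<and> (\<forall>a\<in>E. \<forall>b\<in>E. a \<oplus> b \<in> E)"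
  using assms(2)
proof (induction n K \<equiv> "{\<zero>, \<one>}" E rule: dimension.induct)
  case zero_dim
  then show ?case by auto
next
  case (Suc_dim v E n)
  have double: "a \<oplus> a = \<zero>" if "a \<in> carrier R" for a
    using that assms(1) by (metis l_distr l_null l_one one_closed)
  have E: "E \<subseteq> carrier R" "finite E" "card E = 2 ^ n" "\<zero> \<in> E"
      "\<And>a b. a \<in> E \<Longrightarrow> b \<in> E \<Longrightarrow> a \<oplus> b \<in> E"
    using Suc_dim by auto
  note ext = line_extension_prime_field[OF \<open>v \<in> carrier R\<close> E(1)]
  have cancel: "v \<oplus> (v \<oplus> e) = e" if "e \<in> carrier R" for e
    using that Suc_dim(1) double by (metis a_assoc l_zero)
  have inj: "inj_on (\<lambda>e. v \<oplus> e) E"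
    using E(1) Suc_dim(1) unfolding inj_on_def by (metis cancel subsetD)
  have disj: "E \<inter> (\<lambda>e. v \<oplus> e) ` E = {}"
  proof -
    have False if "e \<in> E" "v \<oplus> e \<in> E" for e
    proof -
      have "e \<in> carrier R" using that E(1) by auto
      then have "v = (v \<oplus> e) \<oplus> e" using Suc_dim(1) double by (simp add: a_assoc)
      then show False using E(5)[OF that(2,1)] Suc_dim(2) by simp
    qed
    then show ?thesis by auto
  qed
  have "card (line_extension {\<zero>, \<one>} v E) = 2 ^ Suc n"
    unfolding ext using E disj by (simp add: card_Un_disjoint card_image[OF inj])
  moreover have "a \<oplus> b \<in> E \<union> (\<lambda>e. v \<oplus> e) ` E"
    if ab: "a \<in> E \<union> (\<lambda>e. v \<oplus> e) ` E" "b \<in> E \<union> (\<lambda>e. v \<oplus> e) ` E" for a b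
  proof -
    have v: "v \<in> carrier R" by fact
    have *: "x \<oplus> y \<in> E" "x \<oplus> (v \<oplus> y) \<in> (\<lambda>e. v \<oplus> e) ` E" "(v \<oplus> x) \<oplus> y \<in> (\<lambda>e. v \<oplus> e) ` E"
      "(v \<oplus> x) \<oplus> (v \<oplus> y) \<in> E" if "x \<in> E" "y \<in> E" for x y
    proof -
      have c: "x \<in> carrier R" "y \<in> carrier R" using that E(1) by auto
      show "x \<oplus> y \<in> E" using E(5) that by auto
      have "x \<oplus> (v \<oplus> y) = v \<oplus> (x \<oplus> y)" "(v \<oplus> x) \<oplus> y = v \<oplus> (x \<oplus> y)"
        using c v by (simp_all add: a_ac)
      then show "x \<oplus> (v \<oplus> y) \<in> (\<lambda>e. v \<oplus> e) ` E" "(v \<oplus> x) \<oplus> y \<in> (\<lambda>e. v \<oplus> e) ` E"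
        using E(5) that by auto
      have "(v \<oplus> x) \<oplus> (v \<oplus> y) = v \<oplus> (v \<oplus> (x \<oplus> y))" using c v by (simp add: a_ac)
      then show "(v \<oplus> x) \<oplus> (v \<oplus> y) \<in> E"
        using c cancel[of "x \<oplus> y"] E(5) that by simp
    qed
    from ab consider (1) "a \<in> E" "b \<in> E" | (2) y where "a \<in> E" "y \<in> E" "b = v \<oplus> y"
      | (3) x where "x \<in> E" "b \<in> E" "a = v \<oplus> x" | (4) x y where "x \<in> E" "y \<in> E" "a = v \<oplus> x" "b = v \<oplus> y"
      by blast
    then show ?thesis using * by cases auto
  qed
  ultimately show ?case using E Suc_dim(1) unfolding ext by auto
qed

text \<open>A subspace of \<open>E\<close> of largest dimension is all of \<open>E\<close>, since
  any further vector of \<open>E\<close> would extend it. A largest dimension exists because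
  dimension \<open>n\<close> takes \<open>2 ^ n > n\<close> elements.\<close>

lemma (in ring) dimension_exists:
  assumes "\<one> \<oplus> \<one> = \<zero>" "E \<subseteq> carrier R" "finite E" "\<zero> \<in> E" "\<And>a b. a \<in> E \<Longrightarrow> b \<in> E \<Longrightarrow> a \<oplus> b \<in> E"
  shows "\<exists>n. dimension n {\<zero>, \<one>} E"
proof -
  define P where "P n \<longleftrightarrow> (\<exists>F\<subseteq>E. dimension n {\<zero>, \<one>} F)" for n
  have "P 0" unfolding P_def using assms(4) by blast
  moreover have bound: "n < card E" if Pn: "P n" for n
  proof -
    from Pn obtain F where F: "F \<subseteq> E" "dimension n {\<zero>, \<one>} F" unfolding P_def by auto
    have "2 ^ n \<le> card E"
      using card_of_dimension[OF assms(1) F(2)] card_mono[OF assms(3) F(1)] by simp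
    then show ?thesis using less_exp[of n] by linarith
  qed
  ultimately obtain n where n: "P n" "\<And>m. P m \<Longrightarrow> m \<le> n"
    using Nat.ex_has_greatest_nat[of P 0 "card E"] by (metis less_imp_le)
  then obtain F where F: "F \<subseteq> E" "dimension n {\<zero>, \<one>} F" unfolding P_def by auto
  have "F = E"
  proof (rule ccontr)
    assume "F \<noteq> E"
    then obtain v where v: "v \<in> E" "v \<notin> F" using F(1) by auto
    have "dimension (Suc n) {\<zero>, \<one>} (line_extension {\<zero>, \<one>} v F)"
      using v assms(2) F by (auto intro: Suc_dim)
    moreover have "line_extension {\<zero>, \<one>} v F \<subseteq> E"
      using v assms(2,5) F(1) by (subst line_extension_prime_field) auto
    ultimately have "P (Suc n)" unfolding P_def by blast
    then show False using n(2) by fastforce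
  qed
  then show ?thesis using F by auto
qed

lemma card_eq_power_dim2:
  assumes "ring A" "\<one>\<^bsub>A\<^esub> \<oplus>\<^bsub>A\<^esub> \<one>\<^bsub>A\<^esub> = \<zero>\<^bsub>A\<^esub>" "E \<subseteq> carrier A" "finite E" "\<zero>\<^bsub>A\<^esub> \<in> E"
    "\<And>a b. a \<in> E \<Longrightarrow> b \<in> E \<Longrightarrow> a \<oplus>\<^bsub>A\<^esub> b \<in> E"
  shows "fin_dim2 A E" "card E = 2 ^ dim2 A E"
proof -
  interpret A: ring A by fact
  obtain n where n: "A.dimension n {\<zero>\<^bsub>A\<^esub>, \<one>\<^bsub>A\<^esub>} E"
    using A.dimension_exists assms by blast
  \<comment> \<open>\<open>dim\<close> is a definite description, so uniqueness has to be shown; the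
    size \<open>2 ^ n\<close> determines \<open>n\<close>.\<close>
  have uniq: "m = n" if "A.dimension m {\<zero>\<^bsub>A\<^esub>, \<one>\<^bsub>A\<^esub>} E" for m
    using A.card_of_dimension[OF assms(2) that] A.card_of_dimension[OF assms(2) n] by simp
  show "fin_dim2 A E" unfolding fin_dim2_def A.finite_dimension_def using n by blast
  have "dim2 A E = n"
    unfolding dim2_def A.dim_def over_def using n uniq by (rule the_equality)
  then show "card E = 2 ^ dim2 A E" using A.card_of_dimension[OF assms(2) n] by simp
qed

section \<open>Counting in finite groups\<close>

text \<open>Additive subgroups, by the one-step subgroup criterion.\<close>

definition closed_diff :: "'a::ab_group_add set \<Rightarrow> bool"
  where "closed_diff V \<longleftrightarrow> 0 \<in> V \<and> (\<forall>a\<in>V. \<forall>b\<in>V. a - b \<in> V)"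

lemma closed_diffD:
  assumes "closed_diff V"
  shows "0 \<in> V" "a \<in> V \<Longrightarrow> b \<in> V \<Longrightarrow> a - b \<in> V" "a \<in> V \<Longrightarrow> b \<in> V \<Longrightarrow> a + b \<in> V"
proof -
  show 0: "0 \<in> V" and d: "a \<in> V \<Longrightarrow> b \<in> V \<Longrightarrow> a - b \<in> V" for a b
    using assms by (auto simp: closed_diff_def)
  show "a \<in> V \<Longrightarrow> b \<in> V \<Longrightarrow> a + b \<in> V" using d[of a "0 - b"] d[of 0 b] 0 by simp
qed

text \<open>Counting form of the first isomorphism theorem: each fibre is a translate of
  \<open>V \<inter> K\<close>. Prescribing the fibres lets \<open>\<phi>\<close> take values in
  cosets or pairs of cosets.\<close>

lemma card_image_mult_kernel:
  assumes "finite V" "closed_diff V"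
    and eq: "\<And>a b. a \<in> V \<Longrightarrow> b \<in> V \<Longrightarrow> \<phi> a = \<phi> b \<longleftrightarrow> a - b \<in> K"
  shows "card (\<phi> ` V) * card (V \<inter> K) = card V"
proof -
  note V = closed_diffD[OF assms(2)]
  have fiber: "card {a \<in> V. \<phi> a = w} = card (V \<inter> K)" if "w \<in> \<phi> ` V" for w
  proof -
    from that obtain b where b: "b \<in> V" "w = \<phi> b" by auto
    have "bij_betw (\<lambda>a. a - b) {a \<in> V. \<phi> a = w} (V \<inter> K)"
      using b V eq by (intro bij_betw_byWitness[of _ "\<lambda>k. k + b"]) auto
    then show ?thesis by (rule bij_betw_same_card)
  qed
  have "card V = (\<Sum>w\<in>\<phi> ` V. card {a \<in> V. \<phi> a = w})"
    using sum.image_gen[OF assms(1), of "\<lambda>_. 1::nat" \<phi>] by simp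
  then show ?thesis using fiber by simp
qed

section \<open>Characters with values 1 and -1, and orthogonal complements\<close>

definition bit_sign :: "bit \<Rightarrow> int"
  where "bit_sign b = (if b = 0 then 1 else -1)"

lemma bit_sign_add: "bit_sign (a + b) = bit_sign a * bit_sign b"
  by (cases a; cases b) (auto simp: bit_sign_def)

text \<open>Orthogonality of characters: translating by some \<open>w\<close> with
  \<open>h w \<noteq> 0\<close> permutes \<open>V\<close> and flips every sign, so the sum equals
  its own negative.\<close>

lemma sum_bit_sign:
  assumes "finite V" "closed_diff V" and add: "\<And>a b. h (a + b) = h a + h b"
  shows "(\<Sum>v\<in>V. bit_sign (h v)) = (if \<forall>v\<in>V. h v = 0 then int (card V) else 0)"
proof (cases "\<forall>v\<in>V. h v = 0")
  case True
  then show ?thesis by (simp add: bit_sign_def)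
next
  case False
  note V = closed_diffD[OF assms(2)]
  from False obtain w where w: "w \<in> V" "h w \<noteq> 0" by auto
  have "(\<Sum>v\<in>V. bit_sign (h v)) = (\<Sum>v\<in>V. bit_sign (h (v + w)))"
    by (rule sum.reindex_bij_witness[of _ "\<lambda>v. v + w" "\<lambda>v. v - w"]) (use w V in auto)
  also have "\<dots> = - (\<Sum>v\<in>V. bit_sign (h v))"
    using w(2) unfolding add bit_sign_add by (simp add: bit_sign_def sum_negf)
  finally have "(\<Sum>v\<in>V. bit_sign (h v)) = 0" by simp
  then show ?thesis using False by (simp only: if_False)
qed

text \<open>Double counting of the signs of \<open>B v j\<close>. Summing over \<open>J\<close>
  first leaves the \<open>v\<close> orthogonal to \<open>J\<close>, each with weight
  \<open>card J\<close>; summing over \<open>V\<close> first leaves, by nondegeneracy, only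
  \<open>j = 0\<close> with weight \<open>card V\<close>.\<close>

lemma card_orthogonal:
  fixes B :: "'a::ab_group_add \<Rightarrow> 'a \<Rightarrow> bit"
  assumes V: "finite V" "closed_diff V" and J: "J \<subseteq> V" "closed_diff J"
    and add: "\<And>a b c. B (a + b) c = B a c + B b c" "\<And>a b c. B a (b + c) = B a b + B a c"
    and nondeg: "\<And>j. j \<in> J \<Longrightarrow> j \<noteq> 0 \<Longrightarrow> \<exists>v\<in>V. B v j \<noteq> 0"
  shows "card J * card {v \<in> V. \<forall>j\<in>J. B v j = 0} = card V"
proof -
  have fJ: "finite J" using V(1) J(1) finite_subset by auto
  have B0: "B v 0 = 0" for v using add(2)[of v 0 0] by (cases "B v 0") auto
  have "(\<Sum>v\<in>V. \<Sum>j\<in>J. bit_sign (B v j)) = (\<Sum>v\<in>V. if \<forall>j\<in>J. B v j = 0 then int (card J) else 0)"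
    by (intro sum.cong refl sum_bit_sign fJ J add)
  also have "\<dots> = int (card J * card {v \<in> V. \<forall>j\<in>J. B v j = 0})"
    using V(1) by (simp add: sum.If_cases Int_def)
  finally have 1: "(\<Sum>v\<in>V. \<Sum>j\<in>J. bit_sign (B v j)) = int (card J * card {v \<in> V. \<forall>j\<in>J. B v j = 0})" .
  have "(\<Sum>j\<in>J. \<Sum>v\<in>V. bit_sign (B v j)) = (\<Sum>j\<in>J. if \<forall>v\<in>V. B v j = 0 then int (card V) else 0)"
    by (intro sum.cong refl sum_bit_sign V add)
  also have "\<dots> = (\<Sum>j\<in>J. if j = 0 then int (card V) else 0)"
    using nondeg B0 by (intro sum.cong refl if_cong) blast+
  also have "\<dots> = int (card V)"
    using fJ closed_diffD(1)[OF J(2)] by (simp add: sum.delta)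
  finally show ?thesis using 1 sum.swap[of "\<lambda>v j. bit_sign (B v j)" J V] by linarith
qed

section \<open>Laurent polynomials\<close>

abbreviation lookup :: "('a \<Rightarrow>\<^sub>0 'b::zero) \<Rightarrow> 'a \<Rightarrow> 'b"
  where "lookup \<equiv> Poly_Mapping.lookup"

abbreviation keys :: "('a \<Rightarrow>\<^sub>0 'b::zero) \<Rightarrow> 'a set"
  where "keys \<equiv> Poly_Mapping.keys"

declare add_bit_eq_xor [simp del] mult_bit_eq_and [simp del]

lemma laurent_add_self [simp]: "p + p = (0 :: laurent)"
proof (rule poly_mapping_eqI)
  fix k show "lookup (p + p) k = lookup (0::laurent) k"
    unfolding lookup_add by (cases "lookup p k") auto
qed

lemma laurent_2 [simp]: "(2 :: laurent) = 0"
  using laurent_add_self[of 1] by (simp only: one_add_one)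

lemma laurent_uminus [simp]: "- p = (p :: laurent)"
  by (rule minus_unique) simp

text \<open>As a simp rule this removes subtraction, which is why ideals and cosets are handled with
  sums below.\<close>

lemma laurent_minus [simp]: "p - q = p + (q :: laurent)"
  using diff_conv_add_uminus[of p q] by (simp only: laurent_uminus)

lemma laurent_add_cancel: "p + (p + q) = (q :: laurent)" "p + (q + p) = (q :: laurent)"
  by (simp_all only: add.left_commute[of p q p] add.assoc[symmetric, of p p q] laurent_add_self) simp_all

lemma lookup_mult_group:
  fixes p q :: "'a::ab_group_add \<Rightarrow>\<^sub>0 'b::comm_semiring_1"
  shows "lookup (p * q) k = (\<Sum>c\<in>keys p. lookup p c * lookup q (k - c))"
proof -
  have "(\<Sum>d. lookup q d when k = c + d) = lookup q (k - c)" for c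
  proof -
    have "(k = c + d) = (k - c = d)" for d by (auto simp: algebra_simps)
    then show ?thesis by simp
  qed
  then have "lookup (p * q) k = (\<Sum>c. lookup p c * lookup q (k - c))"
    by (simp add: lookup_mult)
  also have "\<dots> = (\<Sum>c\<in>keys p. lookup p c * lookup q (k - c))"
    by (rule Sum_any.expand_superset) (auto simp: in_keys_iff)
  finally show ?thesis .
qed

lemma lookup_xy_mult: "lookup (xy n m * p) c = lookup p (c - (n, m))"
  by (simp add: xy_def lookup_mult_group)

lemma xy_mult_xy: "xy n m * xy n' m' = xy (n + n') (m + m')"
  by (simp add: xy_def mult_single)

lemma xy_0_0: "xy 0 0 = 1"
  by (simp add: xy_def flip: zero_prod_def)

lemma lookup_sum_xy:
  assumes "finite A"
  shows "lookup (\<Sum>(n, m)\<in>A. xy n m) k = (if k \<in> A then 1 else 0)"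
proof -
  have "lookup (\<Sum>(n, m)\<in>A. xy n m) k = (\<Sum>c\<in>A. if c = k then 1 else 0)"
    unfolding lookup_sum by (intro sum.cong) (auto simp: xy_def lookup_single when_def)
  then show ?thesis using assms by simp
qed

lemma laurent_eq_sum_xy: "p = (\<Sum>(n, m)\<in>keys p. xy n m)"
proof (rule poly_mapping_eqI)
  fix k
  show "lookup p k = lookup (\<Sum>(n, m)\<in>keys p. xy n m) k"
    unfolding lookup_sum_xy[OF finite_keys] by (cases "lookup p k") (auto simp: in_keys_iff)
qed

lemma laurent_induct [case_names zero add]:
  assumes "P 0" "\<And>p n m. P p \<Longrightarrow> P (xy n m + p)"
  shows "P (p :: laurent)"
proof -
  have "P (\<Sum>(n, m)\<in>A. xy n m)" if "finite A" for A
    using that by induction (use assms in auto)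
  then show ?thesis using laurent_eq_sum_xy[of p] finite_keys[of p] by metis
qed

section \<open>The antipode and the commutation pairing\<close>

lemma inj_uminus_group: "inj (uminus :: 'a::ab_group_add \<Rightarrow> 'a)"
  by (auto simp: inj_def)

lemma lookup_antipode: "lookup (antipode p) c = lookup p (- c)"
  by (simp add: antipode_def map_key.rep_eq[OF inj_uminus_group])

lemma keys_antipode: "keys (antipode p) = uminus ` keys p"
proof -
  have "c \<in> uminus ` keys p" if "- c \<in> keys p" for c
    using imageI[OF that, of uminus] by simp
  then show ?thesis by (auto simp: in_keys_iff lookup_antipode)
qed

lemma antipode_add: "antipode (p + q) = antipode p + antipode q"
  by (rule poly_mapping_eqI) (simp only: lookup_antipode lookup_add)

lemma antipode_mult: "antipode (p * q) = antipode p * antipode q"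
proof (rule poly_mapping_eqI)
  fix k
  have "lookup (antipode p * antipode q) k
      = (\<Sum>c\<in>keys p. lookup p c * lookup q (- k - c))"
    unfolding lookup_mult_group keys_antipode
    by (subst sum.reindex) (auto simp: inj_on_def lookup_antipode intro!: sum.cong arg_cong[of _ _ "lookup q"])
  also have "\<dots> = lookup (p * q) (- k)"
    unfolding lookup_mult_group ..
  finally show "lookup (antipode (p * q)) k = lookup (antipode p * antipode q) k"
    by (simp add: lookup_antipode)
qed

lemma antipode_antipode [simp]: "antipode (antipode p) = p"
  by (rule poly_mapping_eqI) (simp add: lookup_antipode)

text \<open>Reflecting \<open>q\<close> turns the cellwise pairing into convolution, so that
  commuting with all translates of a generator becomes the vanishing of a polynomial.\<close>

lemma overlap_xy_antipode: "overlap p (xy n m * antipode q) = lookup (p * q) (n, m)"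
  unfolding overlap_def lookup_xy_mult lookup_antipode minus_diff_eq
  unfolding lookup_mult_group ..

lemma overlap_0: "overlap p 0 = 0" "overlap 0 p = 0"
  by (simp_all add: overlap_def)

text \<open>The topological order condition for \<open>X\<close>-type operators says that the Koszul complex of
  \<open>f\<close> and \<open>g\<close> is exact in the middle.\<close>

lemma topological_order_exact:
  assumes "topological_order f g" "a * g + b * f = 0"
  shows "\<exists>s. a = s * f \<and> b = s * g"
proof -
  \<comment> \<open>The pair \<open>(a, b)\<close> is read as a pure \<open>X\<close>-type operator;
    its commutators with the translated \<open>Z\<close>-type generators are the coefficients of
    \<open>a * g + b * f\<close>.\<close>
  have "commute ((a, b), (0, 0)) Q" if "Q \<in> stabilizer_generators f g" for Q
  proof -
    have "overlap a (xy n m * antipode g) + overlap b (xy n m * antipode f) = 0" for n m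
      using assms(2) unfolding overlap_xy_antipode lookup_add[symmetric] by simp
    then show ?thesis using that by (auto simp: stabilizer_generators_def overlap_0)
  qed
  then obtain A where A: "finite A" "A \<subseteq> stabilizer_generators f g" "((a, b), (0, 0)) = (\<Sum>Q\<in>A. Q)"
    using assms(1) unfolding topological_order_def by blast
  \<comment> \<open>In the \<open>X\<close>-part, an \<open>X\<close>-type generator contributes a
    monomial multiple of \<open>(f, g)\<close> and a \<open>Z\<close>-type generator contributes
    zero; the multiples add up to one \<open>s\<close>.\<close>
  have "\<exists>s. fst (\<Sum>Q\<in>A. Q) = (s * f, s * g)"
    using A(1,2)
  proof induction
    case empty
    show ?case by (auto intro!: exI[of _ 0] simp: zero_prod_def)
  next
    case (insert Q A)
    then obtain s where s: "fst (\<Sum>Q\<in>A. Q) = (s * f, s * g)" by auto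
    obtain t where t: "fst Q = (t * f, t * g)"
    proof -
      have "(\<exists>n m. fst Q = (xy n m * f, xy n m * g)) \<or> fst Q = (0 * f, 0 * g)"
        using insert.prems by (simp add: stabilizer_generators_def) force
      then show thesis using that by blast
    qed
    have "fst (\<Sum>Q\<in>insert Q A. Q) = ((t + s) * f, (t + s) * g)"
      using insert.hyps s t by (simp add: distrib_right)
    then show ?case by blast
  qed
  then show ?thesis using A(3) by (metis fst_conv prod.inject)
qed

section \<open>Ideals and cosets\<close>

text \<open>Bridge between ideals of the record \<open>cring_class_ops\<close> and the arithmetic of
  the type class, in which the later computations run.\<close>

lemma ideal_class_iff:
  fixes J :: "'a::comm_ring_1 set"
  shows "ideal J cring_class_ops \<longleftrightarrow> closed_diff J \<and> (\<forall>a\<in>J. \<forall>r. r * a \<in> J)"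
proof
  assume "ideal J cring_class_ops"
  then interpret ideal J "cring_class_ops :: 'a ring" .
  have "0 \<in> J" using zero_closed by (simp add: class_simps)
  moreover have "r * a \<in> J" if "a \<in> J" for a r
    using I_l_closed[OF that, of r] by (simp add: class_simps carrier_class)
  moreover have "a - b \<in> J" if "a \<in> J" "b \<in> J" for a b
    using a_closed[OF that(1) calculation(2)[OF that(2), of "-1"]] by (simp add: class_simps)
  ultimately show "closed_diff J \<and> (\<forall>a\<in>J. \<forall>r. r * a \<in> J)" by (simp add: closed_diff_def)
next
  assume *: "closed_diff J \<and> (\<forall>a\<in>J. \<forall>r. r * a \<in> J)"
  then have J: "0 \<in> J" "a \<in> J \<Longrightarrow> b \<in> J \<Longrightarrow> a + b \<in> J" "a \<in> J \<Longrightarrow> - a \<in> J" for a b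
    using closed_diffD[of J] closed_diffD(2)[of J 0 a] by auto
  have "inv\<^bsub>add_monoid (cring_class_ops :: 'a ring)\<^esub> a = - a" for a :: 'a
    using uminus_class[of a] by (simp only: a_inv_def)
  with J have "subgroup J (add_monoid (cring_class_ops :: 'a ring))"
    by (intro subgroup.intro) (auto simp add: class_simps carrier_class)
  then show "ideal J cring_class_ops"
    using * by (intro idealI cring_class.ring_axioms) (auto simp: class_simps mult.commute)
qed

lemma coset_class: "J +>\<^bsub>cring_class_ops\<^esub> p = {q. q - p \<in> J}"
  by (auto simp: a_r_coset_def' class_simps intro!: bexI[where x = "_ - p"])

lemma coset_class_eq_iff:
  fixes J :: "'a::comm_ring_1 set"
  assumes "closed_diff J"
  shows "J +>\<^bsub>cring_class_ops\<^esub> p = J +>\<^bsub>cring_class_ops\<^esub> q \<longleftrightarrow> p - q \<in> J"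
proof
  note J = closed_diffD[OF assms]
  show "p - q \<in> J" if "J +>\<^bsub>cring_class_ops\<^esub> p = J +>\<^bsub>cring_class_ops\<^esub> q"
  proof -
    have "p \<in> {q. q - p \<in> J}" using J(1) by simp
    then show ?thesis using that unfolding coset_class by auto
  qed
  show "J +>\<^bsub>cring_class_ops\<^esub> p = J +>\<^bsub>cring_class_ops\<^esub> q" if "p - q \<in> J"
  proof -
    have "r - p \<in> J \<longleftrightarrow> r - q \<in> J" for r
      using J(2)[of "r - q" "p - q"] J(3)[of "r - p" "p - q"] that by auto
    then show ?thesis unfolding coset_class by simp
  qed
qed

text \<open>The index of \<open>J\<close> in the ring. An infinite quotient gets the value 0, so a
  positive index certifies finiteness.\<close>

definition ideal_index :: "'a::comm_ring_1 set \<Rightarrow> nat"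
  where "ideal_index J = card (range (\<lambda>p. J +>\<^bsub>cring_class_ops\<^esub> p))"

lemma Quot_class_simps:
  fixes J :: "'a::comm_ring_1 set"
  assumes "ideal J cring_class_ops"
  defines "Q \<equiv> cring_class_ops Quot J"
  shows "ring Q" "carrier Q = range (\<lambda>p. J +>\<^bsub>cring_class_ops\<^esub> p)"
    "\<zero>\<^bsub>Q\<^esub> = J +>\<^bsub>cring_class_ops\<^esub> 0" "\<one>\<^bsub>Q\<^esub> = J +>\<^bsub>cring_class_ops\<^esub> 1"
    "(J +>\<^bsub>cring_class_ops\<^esub> p) \<oplus>\<^bsub>Q\<^esub> (J +>\<^bsub>cring_class_ops\<^esub> q) = J +>\<^bsub>cring_class_ops\<^esub> (p + q)"
    "(J +>\<^bsub>cring_class_ops\<^esub> p) \<otimes>\<^bsub>Q\<^esub> (J +>\<^bsub>cring_class_ops\<^esub> q) = J +>\<^bsub>cring_class_ops\<^esub> (p * q)"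
proof -
  interpret ideal J "cring_class_ops :: 'a ring" by fact
  show "ring Q" unfolding Q_def by (rule quotient_is_ring)
  show "carrier Q = range (\<lambda>p. J +>\<^bsub>cring_class_ops\<^esub> p)"
    by (auto simp: Q_def FactRing_def A_RCOSETS_def' carrier_class)
  show "\<zero>\<^bsub>Q\<^esub> = J +>\<^bsub>cring_class_ops\<^esub> 0"
    by (simp add: Q_def FactRing_def coset_class)
  show "\<one>\<^bsub>Q\<^esub> = J +>\<^bsub>cring_class_ops\<^esub> 1"
    by (simp add: Q_def FactRing_def class_simps)
  show "(J +>\<^bsub>cring_class_ops\<^esub> p) \<oplus>\<^bsub>Q\<^esub> (J +>\<^bsub>cring_class_ops\<^esub> q) = J +>\<^bsub>cring_class_ops\<^esub> (p + q)"
    using a_rcos_sum[of p q] by (simp add: Q_def FactRing_def class_simps carrier_class)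
  show "(J +>\<^bsub>cring_class_ops\<^esub> p) \<otimes>\<^bsub>Q\<^esub> (J +>\<^bsub>cring_class_ops\<^esub> q) = J +>\<^bsub>cring_class_ops\<^esub> (p * q)"
    using rcoset_mult_add[of p q] by (simp add: Q_def FactRing_def class_simps carrier_class)
qed

section \<open>Finiteness of the quotient\<close>

definition supported :: "(int \<times> int) set \<Rightarrow> laurent set"
  where "supported P = {p. keys p \<subseteq> P}"

lemma closed_diff_supported: "closed_diff (supported P)"
  using Poly_Mapping.keys_add by (fastforce simp: closed_diff_def supported_def)

text \<open>Over two elements a Laurent polynomial is the same thing as its support.\<close>

lemma card_supported:
  assumes "finite P"
  shows "finite (supported P)" "card (supported P) = 2 ^ card P"
proof -
  have keys_sum: "keys (\<Sum>(n, m)\<in>A. xy n m) = A" if "A \<subseteq> P" for A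
    using finite_subset[OF that assms] by (auto simp: in_keys_iff lookup_sum_xy split: if_splits)
  have bij: "bij_betw keys (supported P) (Pow P)"
    by (rule bij_betw_byWitness[of _ "\<lambda>A. \<Sum>(n, m)\<in>A. xy n m"])
       (auto simp: keys_sum supported_def simp flip: laurent_eq_sum_xy)
  show "finite (supported P)" using bij_betw_finite[OF bij] assms by simp
  show "card (supported P) = 2 ^ card P" using bij_betw_same_card[OF bij] assms by (simp add: card_Pow)
qed

text \<open>Order exponents by \<open>u\<close>, ties broken by \<open>v\<close>; \<open>inj\<close>
  makes leading exponents unique. The product of the two leading monomials cannot cancel, so its
  exponent survives in \<open>p * q\<close>.\<close>

lemma extremal_key_mult:
  fixes u v :: "int \<times> int \<Rightarrow> int"
  assumes add: "\<And>a b. u (a + b) = u a + u b" "\<And>a b. v (a + b) = v a + v b"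
    and inj: "\<And>a b. u a = u b \<Longrightarrow> v a = v b \<Longrightarrow> a = b"
    and nz: "p \<noteq> 0" "q \<noteq> (0::laurent)"
  shows "\<exists>c\<in>keys (p * q). \<forall>a\<in>keys p. \<forall>b\<in>keys q. u a + u b \<le> u c"
proof -
  have lex: "\<exists>a\<in>K. \<forall>a'\<in>K. u a' < u a \<or> u a' = u a \<and> v a' \<le> v a" if K: "finite K" "K \<noteq> {}" for K
  proof -
    define M where "M = {a \<in> K. u a = Max (u ` K)}"
    have "Max (u ` K) \<in> u ` K" using K by simp
    then obtain a where "a \<in> K" "u a = Max (u ` K)" by auto
    then have "M \<noteq> {}" unfolding M_def by blast
    moreover have "finite M" using K(1) by (simp add: M_def)
    ultimately have M: "finite M" "M \<noteq> {}" by simp_all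
    then have "Max (v ` M) \<in> v ` M" by simp
    then obtain a where a: "a \<in> M" "v a = Max (v ` M)" by auto
    have "u a' < u a \<or> u a' = u a \<and> v a' \<le> v a" if "a' \<in> K" for a'
    proof (cases "a' \<in> M")
      case True
      then show ?thesis using a M by (auto simp: M_def)
    next
      case False
      moreover have "u a' \<le> Max (u ` K)" using K that by simp
      ultimately show ?thesis using a that by (auto simp: M_def)
    qed
    moreover have "a \<in> K" using a(1) by (simp add: M_def)
    ultimately show ?thesis by blast
  qed
  obtain a where a: "a \<in> keys p" "\<And>a'. a' \<in> keys p \<Longrightarrow> u a' < u a \<or> u a' = u a \<and> v a' \<le> v a"
    using lex[of "keys p"] nz by auto
  obtain b where b: "b \<in> keys q" "\<And>b'. b' \<in> keys q \<Longrightarrow> u b' < u b \<or> u b' = u b \<and> v b' \<le> v b"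
    using lex[of "keys q"] nz by auto
  \<comment> \<open>The leading pair is the only way to reach the exponent \<open>a + b\<close>:
    equality in both \<open>u\<close> and \<open>v\<close> is forced.\<close>
  have only: "c = a" if c: "c \<in> keys p" "a + b - c \<in> keys q" for c
  proof (rule inj)
    have "u (a + b - c) + u c = u a + u b" "v (a + b - c) + v c = v a + v b"
      using add(1)[of "a + b - c" c] add(2)[of "a + b - c" c] by (simp_all add: add)
    then show "u c = u a" "v c = v a" using a(2)[OF c(1)] b(2)[OF c(2)] by auto
  qed
  have "lookup (p * q) (a + b) = (\<Sum>c\<in>keys p. if c = a then lookup p a * lookup q b else 0)"
    unfolding lookup_mult_group
  proof (intro sum.cong refl)
    fix c assume "c \<in> keys p"
    then show "lookup p c * lookup q (a + b - c) = (if c = a then lookup p a * lookup q b else 0)"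
      using only[of c] by (cases "a + b - c \<in> keys q") (auto simp: in_keys_iff)
  qed
  also have "\<dots> = lookup p a * lookup q b" using a(1) by simp
  finally have "a + b \<in> keys (p * q)" using a(1) b(1) by (simp add: in_keys_iff)
  moreover have "u a' + u b' \<le> u (a + b)" if "a' \<in> keys p" "b' \<in> keys q" for a' b'
    using a(2)[OF that(1)] b(2)[OF that(2)] unfolding add by linarith
  ultimately show ?thesis by blast
qed

text \<open>Half-open, so that side lengths are plain differences of the bounds.\<close>

definition rect :: "int \<Rightarrow> int \<Rightarrow> int \<Rightarrow> int \<Rightarrow> (int \<times> int) set"
  where "rect l1 u1 l2 u2 = {l1..<u1} \<times> {l2..<u2}"

lemma finite_rect: "finite (rect l1 u1 l2 u2)"
  by (simp add: rect_def)

lemma card_rect: "l1 \<le> u1 \<Longrightarrow> l2 \<le> u2 \<Longrightarrow> int (card (rect l1 u1 l2 u2)) = (u1 - l1) * (u2 - l2)"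
  by (simp add: rect_def)

definition lo :: "(int \<times> int \<Rightarrow> int) \<Rightarrow> laurent \<Rightarrow> int"
  where "lo h p = Min (h ` keys p)"

definition hi :: "(int \<times> int \<Rightarrow> int) \<Rightarrow> laurent \<Rightarrow> int"
  where "hi h p = Max (h ` keys p)"

lemma lo_le: "c \<in> keys p \<Longrightarrow> lo h p \<le> h c"
  by (simp add: lo_def)

lemma le_hi: "c \<in> keys p \<Longrightarrow> h c \<le> hi h p"
  by (simp add: hi_def)

lemma lo_le_hi: "p \<noteq> 0 \<Longrightarrow> lo h p \<le> hi h p"
proof -
  assume "p \<noteq> 0"
  then obtain c where "c \<in> keys p" by (metis ex_in_conv keys_eq_empty)
  then show ?thesis using lo_le le_hi order_trans by blast
qed

text \<open>Newton polygons add up under multiplication; bounding rectangles are enough here.\<close>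

lemma mult_supported_rect_iff:
  assumes "g \<noteq> 0"
  shows "s * g \<in> supported (rect l1 u1 l2 u2) \<longleftrightarrow>
    s \<in> supported (rect (l1 - lo fst g) (u1 - hi fst g) (l2 - lo snd g) (u2 - hi snd g))"
proof
  assume s: "s \<in> supported (rect (l1 - lo fst g) (u1 - hi fst g) (l2 - lo snd g) (u2 - hi snd g))"
  have "c \<in> rect l1 u1 l2 u2" if c: "c \<in> keys (s * g)" for c
  proof -
    obtain a b where ab: "a \<in> keys s" "b \<in> keys g" "c = a + b"
      using subsetD[OF Poly_Mapping.keys_mult c] by blast
    have "a \<in> rect (l1 - lo fst g) (u1 - hi fst g) (l2 - lo snd g) (u2 - hi snd g)"
      using ab(1) s by (auto simp: supported_def)
    then show ?thesis
      using ab(3) lo_le[OF ab(2), of fst] lo_le[OF ab(2), of snd] le_hi[OF ab(2), of fst] le_hi[OF ab(2), of snd]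
      by (auto simp: rect_def mem_Times_iff)
  qed
  then show "s * g \<in> supported (rect l1 u1 l2 u2)" by (auto simp: supported_def)
next
  assume sg: "s * g \<in> supported (rect l1 u1 l2 u2)"
  have "c \<in> rect (l1 - lo fst g) (u1 - hi fst g) (l2 - lo snd g) (u2 - hi snd g)" if c: "c \<in> keys s" for c
  proof -
    have "s \<noteq> 0" using c by auto
    \<comment> \<open>Maximum and minimum of each coordinate, the minimum as a maximum of the
      negated one; the other coordinate breaks ties.\<close>
    have ext: "\<exists>c'\<in>keys (s * g). \<forall>a\<in>keys s. \<forall>b\<in>keys g. u a + u b \<le> u c'"
      if "(u, v) \<in> {(fst, snd), (\<lambda>c. - fst c, snd), (snd, fst), (\<lambda>c. - snd c, fst)}" for u v :: "int \<times> int \<Rightarrow> int"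
      by (rule extremal_key_mult[OF _ _ _ \<open>s \<noteq> 0\<close> assms, of u v]) (use that in \<open>auto simp: prod_eq_iff\<close>)
    have in_rect: "l1 \<le> fst a" "fst a < u1" "l2 \<le> snd a" "snd a < u2" if "a \<in> keys (s * g)" for a
      using that sg by (auto simp: supported_def rect_def)
    have bounds: "fst c + fst b < u1" "l1 \<le> fst c + fst b" "snd c + snd b < u2" "l2 \<le> snd c + snd b"
      if b: "b \<in> keys g" for b
    proof -
      show "fst c + fst b < u1"
        using ext[of fst snd] b c in_rect(2) by fastforce
      show "l1 \<le> fst c + fst b"
        using ext[of "\<lambda>c. - fst c" snd] b c in_rect(1) by fastforce
      show "snd c + snd b < u2"
        using ext[of snd fst] b c in_rect(4) by fastforce
      show "l2 \<le> snd c + snd b"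
        using ext[of "\<lambda>c. - snd c" fst] b c in_rect(3) by fastforce
    qed
    have "lo h g \<in> h ` keys g" "hi h g \<in> h ` keys g" for h
      unfolding lo_def hi_def using assms by (intro Min_in Max_in; simp)+
    then have "fst c + hi fst g < u1" "l1 \<le> fst c + lo fst g" "snd c + hi snd g < u2" "l2 \<le> snd c + lo snd g"
      using bounds by (metis imageE)+
    then show ?thesis by (auto simp: rect_def mem_Times_iff)
  qed
  then show "s \<in> supported (rect (l1 - lo fst g) (u1 - hi fst g) (l2 - lo snd g) (u2 - hi snd g))"
    by (auto simp: supported_def)
qed

lemma finite_range_if_eq_image_bounded:
  assumes "\<And>P. finite P \<Longrightarrow> card (F ` P) \<le> C"
  shows "finite (range F)"
  using finite_if_finite_subsets_card_bdd[of "range F" C] assms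
  by (metis finite_subset_image)

text \<open>The exponent is the mixed volume of the two bounding rectangles, as in Bernstein's theorem:
  inclusion-exclusion on the sizes of four rectangles leaves a quantity independent of \<open>M\<close>.\<close>

lemma card_cosets_rect:
  fixes f g :: laurent
  assumes nz: "f \<noteq> 0" "g \<noteq> 0"
    and exact: "\<And>a b. a * g + b * f = 0 \<Longrightarrow> \<exists>s. a = s * f \<and> b = s * g"
    and J: "closed_diff J" "\<And>a b. a * f + b * g \<in> J"
    and M: "2 * M \<ge> hi fst f - lo fst f + hi fst g - lo fst g"
      "2 * M \<ge> hi snd f - lo snd f + hi snd g - lo snd g"
  shows "card ((\<lambda>p. J +>\<^bsub>laurent_ring\<^esub> p) ` supported (rect (- M) M (- M) M)) \<le>
    2 ^ nat ((hi fst f - lo fst f) * (hi snd g - lo snd g) + (hi snd f - lo snd f) * (hi fst g - lo fst g))"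
proof -
  \<comment> \<open>\<open>rC\<close> is the window. \<open>rA\<close> and \<open>rB\<close> hold
    the cofactors whose products with \<open>f\<close> and \<open>g\<close> stay in it, and
    \<open>rE\<close> holds the \<open>s\<close> for which \<open>s * f * g\<close> does.\<close>
  define rC where "rC = rect (- M) M (- M) M"
  define rA where "rA = rect (- M - lo fst f) (M - hi fst f) (- M - lo snd f) (M - hi snd f)"
  define rB where "rB = rect (- M - lo fst g) (M - hi fst g) (- M - lo snd g) (M - hi snd g)"
  define rE where "rE = rect (- M - lo fst f - lo fst g) (M - hi fst f - hi fst g)
    (- M - lo snd f - lo snd g) (M - hi snd f - hi snd g)"
  define K where "K = (hi fst f - lo fst f) * (hi snd g - lo snd g) + (hi snd f - lo snd f) * (hi fst g - lo fst g)"
  note lohi = lo_le_hi[OF nz(1), of fst] lo_le_hi[OF nz(1), of snd] lo_le_hi[OF nz(2), of fst] lo_le_hi[OF nz(2), of snd]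
  have fin: "finite rA" "finite rB" "finite rC" "finite rE"
    by (simp_all add: rA_def rB_def rC_def rE_def finite_rect)
  have "K \<ge> 0" unfolding K_def using lohi by simp
  \<comment> \<open>The lower bounds on \<open>M\<close> keep the sides of all four rectangles
    nonnegative.\<close>
  have "int (card rC) + int (card rE) = int (card rA) + int (card rB) + K"
    unfolding rA_def rB_def rC_def rE_def K_def using M lohi by (simp add: card_rect algebra_simps)
  then have sizes: "card rC + card rE = card rA + card rB + nat K" using \<open>K \<ge> 0\<close> by linarith
  define V where "V = supported rA \<times> supported rB"
  define \<phi> where "\<phi> = (\<lambda>(p, q). p * f + q * (g :: laurent))"
  define N where "N = card ((\<lambda>p. J +>\<^bsub>laurent_ring\<^esub> p) ` supported rC)"
  have V: "finite V" "card V = 2 ^ card rA * 2 ^ card rB"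
    using card_supported fin by (auto simp: V_def card_cartesian_product)
  have "closed_diff V"
    using closed_diff_supported[of rA] closed_diff_supported[of rB]
    by (auto simp: V_def closed_diff_def zero_prod_def)
  then have 1: "card (\<phi> ` V) * card (V \<inter> {z. \<phi> z = 0}) = card V"
  proof (rule card_image_mult_kernel[OF V(1)])
    fix z w
    have "\<phi> (z - w) = \<phi> z - \<phi> w"
      by (cases z; cases w) (simp add: \<phi>_def algebra_simps del: laurent_minus)
    then show "\<phi> z = \<phi> w \<longleftrightarrow> z - w \<in> {z. \<phi> z = 0}" by (simp del: laurent_minus)
  qed
  \<comment> \<open>Exactness parametrizes the relations \<open>p * f + q * g = 0\<close> by
    \<open>s\<close>, and \<open>p = s * g\<close> being supported in \<open>rA\<close> confines
    \<open>s\<close> to \<open>rE\<close>.\<close>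
  have "V \<inter> {z. \<phi> z = 0} \<subseteq> (\<lambda>s. (s * g, s * f)) ` supported rE"
  proof
    fix z assume z: "z \<in> V \<inter> {z. \<phi> z = 0}"
    obtain p q where pq: "z = (p, q)" by (cases z)
    then have "q * g + p * f = 0" using z by (simp add: \<phi>_def add.commute)
    then obtain s where s: "q = s * f" "p = s * g" using exact by blast
    then have "s * g \<in> supported rA" using z pq by (simp add: V_def)
    then have "s \<in> supported rE"
      unfolding rA_def mult_supported_rect_iff[OF nz(2)] rE_def .
    then show "z \<in> (\<lambda>s. (s * g, s * f)) ` supported rE" using pq s by blast
  qed
  then have 2: "card (V \<inter> {z. \<phi> z = 0}) \<le> 2 ^ card rE"
    using surj_card_le[OF card_supported(1)[OF fin(4)]] unfolding card_supported(2)[OF fin(4)] by blast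
  have 3: "N * card (supported rC \<inter> J) = 2 ^ card rC"
    unfolding N_def card_supported(2)[OF fin(3), symmetric]
    by (rule card_image_mult_kernel[OF card_supported(1)[OF fin(3)] closed_diff_supported])
       (rule coset_class_eq_iff[OF J(1)])
  have "\<phi> ` V \<subseteq> supported rC \<inter> J"
  proof -
    have "p * f + q * g \<in> supported rC" if "p \<in> supported rA" "q \<in> supported rB" for p q
      using that closed_diffD(3)[OF closed_diff_supported] mult_supported_rect_iff[OF nz(1)] mult_supported_rect_iff[OF nz(2)]
      unfolding rA_def rB_def rC_def by blast
    then show ?thesis using J(2) by (auto simp: V_def \<phi>_def)
  qed
  then have 4: "card (\<phi> ` V) \<le> card (supported rC \<inter> J)"
    using card_supported(1)[OF fin(3)] by (intro card_mono) auto
  \<comment> \<open>The window contains many elements \<open>p * f + q * g\<close> of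
    \<open>J\<close>, since few pairs share a value; hence it meets few cosets.\<close>
  have "N * 2 ^ (card rA + card rB) = N * card (\<phi> ` V) * card (V \<inter> {z. \<phi> z = 0})"
    using 1 V(2) by (simp add: power_add mult.assoc)
  also have "\<dots> \<le> N * card (supported rC \<inter> J) * 2 ^ card rE"
    using 2 4 by (intro mult_mono) auto
  also have "\<dots> = 2 ^ nat K * 2 ^ (card rA + card rB)"
    unfolding 3 power_add[symmetric] sizes by (simp add: add.commute)
  finally show ?thesis unfolding N_def rC_def K_def by simp
qed

text \<open>Any finite set of polynomials fits into a square window, and the bound on the number of
  cosets met by a window does not grow with it.\<close>

lemma finite_cosets_of_exact:
  fixes f g :: laurent
  assumes exact: "\<And>a b. a * g + b * f = 0 \<Longrightarrow> \<exists>s. a = s * f \<and> b = s * g"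
    and J: "ideal J laurent_ring" "f \<in> J" "g \<in> J"
  shows "finite (range (\<lambda>p. J +>\<^bsub>laurent_ring\<^esub> p))"
proof -
  have cd: "closed_diff J" and J': "\<And>a b. a * f + b * g \<in> J"
    using J closed_diffD(3)[of J] by (auto simp: ideal_class_iff)
  show ?thesis
  proof (cases "f = 0 \<or> g = 0")
    case True
    \<comment> \<open>If one generator vanishes, exactness makes the other a unit.\<close>
    have "1 \<in> J"
    proof -
      from True obtain s where "1 = s * f \<or> 1 = s * g"
        using exact[of 1 0] exact[of 0 1] by auto
      then show ?thesis using J unfolding ideal_class_iff by metis
    qed
    then have "p \<in> J" for p using J(1) by (metis ideal_class_iff mult.right_neutral)
    then show ?thesis by (simp add: coset_class)
  next
    case False
    show ?thesis
    proof (rule finite_range_if_eq_image_bounded)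
      fix P :: "laurent set" assume P: "finite P"
      define m where "m c = max \<bar>fst c\<bar> \<bar>snd c\<bar>" for c :: "int \<times> int"
      \<comment> \<open>\<open>M\<close> has to exceed the exponents occurring in \<open>P\<close>,
        to enclose them in the window, and the two summed widths, for the counting bound.\<close>
      define X where "X = insert (hi fst f - lo fst f + hi fst g - lo fst g)
        (insert (hi snd f - lo snd f + hi snd g - lo snd g) (m ` (\<Union>p\<in>P. keys p)))"
      define M where "M = 1 + \<bar>Max X\<bar>"
      have "finite X" using P by (simp add: X_def)
      then have M: "x < M" if "x \<in> X" for x
        using Max_ge[OF _ that] by (simp add: M_def)
      have "P \<subseteq> supported (rect (- M) M (- M) M)"
      proof -
        have "c \<in> rect (- M) M (- M) M" if "p \<in> P" "c \<in> keys p" for p c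
        proof -
          have "m c < M" using that by (intro M) (auto simp: X_def)
          then show ?thesis by (auto simp: rect_def m_def mem_Times_iff)
        qed
        then show ?thesis by (auto simp: supported_def)
      qed
      then have "card ((\<lambda>p. J +>\<^bsub>laurent_ring\<^esub> p) ` P) \<le> card ((\<lambda>p. J +>\<^bsub>laurent_ring\<^esub> p) ` supported (rect (- M) M (- M) M))"
        by (intro card_mono finite_imageI card_supported finite_rect image_mono)
      also have "\<dots> \<le> 2 ^ nat ((hi fst f - lo fst f) * (hi snd g - lo snd g) + (hi snd f - lo snd f) * (hi fst g - lo fst g))"
      proof (rule card_cosets_rect[OF _ _ exact cd J'])
        have "M \<ge> 0" by (simp add: M_def)
        then show "2 * M \<ge> hi fst f - lo fst f + hi fst g - lo fst g"
          "2 * M \<ge> hi snd f - lo snd f + hi snd g - lo snd g"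
          using M[of "hi fst f - lo fst f + hi fst g - lo fst g"] M[of "hi snd f - lo snd f + hi snd g - lo snd g"]
          by (simp_all add: X_def)
      qed (use False in auto)
      finally show "card ((\<lambda>p. J +>\<^bsub>laurent_ring\<^esub> p) ` P) \<le> \<dots>" .
    qed
  qed
qed

section \<open>The torus ring\<close>

definition torus_lattice :: "nat \<Rightarrow> nat \<Rightarrow> int \<Rightarrow> (int \<times> int) set"
  where "torus_lattice \<alpha> \<beta> \<gamma> = {(i * int \<beta>, i * \<gamma> + j * int \<alpha>) | i j. True}"

lemma closed_diff_lattice: "closed_diff (torus_lattice \<alpha> \<beta> \<gamma>)"
proof -
  have "a - b \<in> torus_lattice \<alpha> \<beta> \<gamma>" if ab: "a \<in> torus_lattice \<alpha> \<beta> \<gamma>" "b \<in> torus_lattice \<alpha> \<beta> \<gamma>" for a b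
  proof -
    obtain i j where a: "a = (i * int \<beta>, i * \<gamma> + j * int \<alpha>)"
      using ab(1) by (auto simp: torus_lattice_def)
    obtain i' j' where b: "b = (i' * int \<beta>, i' * \<gamma> + j' * int \<alpha>)"
      using ab(2) by (auto simp: torus_lattice_def)
    have "a - b = ((i - i') * int \<beta>, (i - i') * \<gamma> + (j - j') * int \<alpha>)"
      unfolding a b
      by (simp add: algebra_simps)
    then show ?thesis unfolding torus_lattice_def by blast
  qed
  moreover have "0 \<in> torus_lattice \<alpha> \<beta> \<gamma>"
    unfolding torus_lattice_def zero_prod_def by (auto intro!: exI[of _ 0])
  ultimately show ?thesis by (simp add: closed_diff_def)
qed

lemma closed_diff_scale:
  fixes G :: "(int \<times> int) set"
  assumes "closed_diff G" "(a, b) \<in> G"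
  shows "(k * a, k * b) \<in> G"
proof (induction k rule: int_induct[of _ 0])
  case base
  show ?case using closed_diffD(1)[OF assms(1)] by (simp add: zero_prod_def)
next
  case (step1 i)
  then show ?case using closed_diffD(3)[OF assms(1) step1(2) assms(2)] by (simp add: algebra_simps)
next
  case (step2 i)
  then show ?case using closed_diffD(2)[OF assms(1) step2(2) assms(2)] by (simp add: algebra_simps)
qed

text \<open>\<open>trace L\<close> is the coefficient of \<open>1\<close> in the group algebra of \<open>\<int>\<^sup>2 / L\<close>: the Frobenius form of the
  torus ring.\<close>

definition trace :: "(int \<times> int) set \<Rightarrow> laurent \<Rightarrow> bit"
  where "trace L p = (\<Sum>c\<in>keys p. of_bool (c \<in> L))"

lemma trace_superset:
  assumes "finite F" "keys p \<subseteq> F"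
  shows "trace L p = (\<Sum>c\<in>F. lookup p c * of_bool (c \<in> L))"
proof -
  have "trace L p = (\<Sum>c\<in>keys p. lookup p c * of_bool (c \<in> L))"
    unfolding trace_def by (intro sum.cong) (auto simp: in_keys_iff)
  also have "\<dots> = (\<Sum>c\<in>F. lookup p c * of_bool (c \<in> L))"
    using assms by (intro sum.mono_neutral_left) (auto simp: in_keys_iff)
  finally show ?thesis .
qed

lemma trace_add: "trace L (p + q) = trace L p + trace L q"
proof -
  have "keys (p + q) \<subseteq> keys p \<union> keys q" by (rule Poly_Mapping.keys_add)
  then show ?thesis
    using trace_superset[of "keys p \<union> keys q"]
    by (simp add: lookup_add distrib_right sum.distrib)
qed

lemma trace_0: "trace L 0 = 0"
  by (simp add: trace_def)

lemma trace_xy: "trace L (xy n m) = of_bool ((n, m) \<in> L)"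
  by (simp add: trace_def xy_def)

lemma trace_xy_mult: "trace L (xy n m * p) = (\<Sum>c\<in>keys p. of_bool ((n, m) + c \<in> L))"
proof -
  have "trace L (xy n m * (\<Sum>(a, b)\<in>A. xy a b)) = (\<Sum>c\<in>A. of_bool ((n, m) + c \<in> L))" if "finite A" for A
    using that
  proof induction
    case empty
    show ?case by (simp add: trace_0)
  next
    case (insert c A)
    then show ?case
      by (cases c) (simp add: distrib_left trace_add trace_xy xy_mult_xy)
  qed
  then show ?thesis using laurent_eq_sum_xy[of p] finite_keys[of p] by metis
qed

lemma trace_lattice_mult:
  assumes "closed_diff L" "(n, m) \<in> L"
  shows "trace L (xy n m * p) = trace L p"
proof -
  have "(n, m) + c \<in> L \<longleftrightarrow> c \<in> L" for c
    using closed_diffD(2)[OF assms(1), of "(n, m) + c" "(n, m)"] closed_diffD(3)[OF assms(1), of "(n, m)" c] assms(2)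
    by auto
  then show ?thesis unfolding trace_xy_mult by (simp add: trace_def)
qed

lemma trace_antipode:
  assumes "closed_diff L"
  shows "trace L (antipode p) = trace L p"
proof -
  have "- c \<in> L \<longleftrightarrow> c \<in> L" for c
    using closed_diffD(2)[OF assms closed_diffD(1)[OF assms], of c]
      closed_diffD(2)[OF assms closed_diffD(1)[OF assms], of "- c"] by auto
  then show ?thesis
    unfolding trace_def keys_antipode by (subst sum.reindex) (auto simp: inj_on_def intro!: sum.cong)
qed

section \<open>A fundamental domain of the lattice\<close>

definition cells :: "nat \<Rightarrow> nat \<Rightarrow> (int \<times> int) set"
  where "cells \<alpha> \<beta> = {0..<int \<beta>} \<times> {0..<int \<alpha>}"

lemma card_cells: "finite (cells \<alpha> \<beta>)" "card (cells \<alpha> \<beta>) = \<alpha> * \<beta>"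
  by (simp_all add: cells_def)

lemma cells_exists:
  assumes "\<alpha> \<ge> 1" "\<beta> \<ge> 1"
  shows "\<exists>d\<in>cells \<alpha> \<beta>. c - d \<in> torus_lattice \<alpha> \<beta> \<gamma>"
proof -
  \<comment> \<open>Removing \<open>q\<close> copies of \<open>(\<beta>, \<gamma>)\<close> brings
    the first coordinate into range; this shifts the second by \<open>q * \<gamma>\<close> before it
    is reduced modulo \<open>\<alpha>\<close>.\<close>
  define q where "q = fst c div int \<beta>"
  define d where "d = (fst c mod int \<beta>, (snd c - q * \<gamma>) mod int \<alpha>)"
  have "fst c - fst d = q * int \<beta>"
    by (simp add: d_def q_def minus_mod_eq_div_mult)
  moreover have "snd c - q * \<gamma> - snd d = (snd c - q * \<gamma>) div int \<alpha> * int \<alpha>"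
    by (simp add: d_def minus_mod_eq_div_mult)
  then have "snd c - snd d = q * \<gamma> + (snd c - q * \<gamma>) div int \<alpha> * int \<alpha>"
    by linarith
  ultimately have "c - d = (q * int \<beta>, q * \<gamma> + (snd c - q * \<gamma>) div int \<alpha> * int \<alpha>)"
    by (simp add: prod_eq_iff)
  then have "c - d \<in> torus_lattice \<alpha> \<beta> \<gamma>" unfolding torus_lattice_def by blast
  moreover have "d \<in> cells \<alpha> \<beta>" using assms by (simp add: d_def cells_def)
  ultimately show ?thesis by blast
qed

lemma cells_unique:
  assumes "c \<in> cells \<alpha> \<beta>" "d \<in> cells \<alpha> \<beta>" "c - d \<in> torus_lattice \<alpha> \<beta> \<gamma>"
  shows "c = d"
proof -
  have small: "x = y" if "x - y = k * n" "0 \<le> x" "x < n" "0 \<le> y" "y < n" for x y k n :: int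
    using that by (metis diff_add_cancel mod_mult_self3 mod_pos_pos_trivial)
  obtain i j where ij: "fst c - fst d = i * int \<beta>" "snd c - snd d = i * \<gamma> + j * int \<alpha>"
    using assms(3) by (auto simp: torus_lattice_def prod_eq_iff)
  have 1: "fst c = fst d"
    using small[OF ij(1)] assms(1,2) by (auto simp: cells_def)
  \<comment> \<open>With \<open>i = 0\<close> the twist drops out of the second coordinate.\<close>
  then have "i = 0" using ij(1) assms(1) by (auto simp: cells_def)
  then have "snd c = snd d"
    using small[of "snd c" "snd d" j "int \<alpha>"] ij(2) assms(1,2) by (auto simp: cells_def)
  with 1 show ?thesis by (simp add: prod_eq_iff)
qed

section \<open>The torus ideal as the radical of the trace form\<close>

lemma ideal_laurent_iff:
  "ideal J laurent_ring \<longleftrightarrow> 0 \<in> J \<and> (\<forall>a\<in>J. \<forall>b\<in>J. a + b \<in> J) \<and> (\<forall>a\<in>J. \<forall>r. r * a \<in> J)"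
  by (simp add: ideal_class_iff closed_diff_def)

lemma ideal_genideal_class: "ideal (Idl\<^bsub>cring_class_ops\<^esub> S) (cring_class_ops :: 'a::comm_ring_1 ring)"
  by (rule ring.genideal_ideal[OF cring.axioms(1)[OF cring_class]]) (auto simp: carrier_class)

lemma genideal_class_self: "x \<in> S \<Longrightarrow> (x :: 'a::comm_ring_1) \<in> Idl\<^bsub>cring_class_ops\<^esub> S"
  by (rule subsetD[OF ring.genideal_self[OF cring.axioms(1)[OF cring_class]]]) (auto simp: carrier_class)

lemma ideal_torus: "ideal (torus_ideal \<alpha> \<beta> \<gamma>) laurent_ring"
  unfolding torus_ideal_def by (rule ideal_genideal_class)

text \<open>The exponents whose monomial is 1 modulo the torus ideal form a group, and it contains
  both generators of the lattice.\<close>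

lemma xy_lattice_torus:
  assumes "(n, m) \<in> torus_lattice \<alpha> \<beta> \<gamma>"
  shows "xy n m + 1 \<in> torus_ideal \<alpha> \<beta> \<gamma>"
proof -
  define T where "T = torus_ideal \<alpha> \<beta> \<gamma>"
  note T = ideal_torus[of \<alpha> \<beta> \<gamma>, folded T_def, unfolded ideal_laurent_iff]
  define G where "G = {c. xy (fst c) (snd c) + 1 \<in> T}"
  have "a - b \<in> G" if "a \<in> G" "b \<in> G" for a b
  proof -
    have "xy (fst (a - b)) (snd (a - b)) + 1 =
        xy (- fst b) (- snd b) * ((xy (fst a) (snd a) + 1) + (xy (fst b) (snd b) + 1))"
      by (simp add: distrib_left xy_mult_xy xy_0_0 add.assoc laurent_add_cancel)
    moreover have "xy (- fst b) (- snd b) * ((xy (fst a) (snd a) + 1) + (xy (fst b) (snd b) + 1)) \<in> T"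
      using that T unfolding G_def mem_Collect_eq by blast
    ultimately show ?thesis by (simp only: G_def mem_Collect_eq)
  qed
  then have G: "closed_diff G"
    using T by (simp add: closed_diff_def G_def xy_0_0)
  have "(0, int \<alpha>) \<in> G" "(int \<beta>, \<gamma>) \<in> G"
    unfolding G_def T_def torus_ideal_def by (auto intro: genideal_class_self)
  moreover obtain i j where "n = i * int \<beta>" "m = i * \<gamma> + j * int \<alpha>"
    using assms by (auto simp: torus_lattice_def)
  ultimately have "(n, m) \<in> G"
    using closed_diffD(3)[OF G closed_diff_scale[OF G] closed_diff_scale[OF G], of "int \<beta>" \<gamma> 0 "int \<alpha>" i j] by simp
  then show ?thesis by (simp add: G_def T_def)
qed

lemma torus_normal_form:
  assumes "\<alpha> \<ge> 1" "\<beta> \<ge> 1"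
  shows "\<exists>r\<in>supported (cells \<alpha> \<beta>). p + r \<in> torus_ideal \<alpha> \<beta> \<gamma>"
proof (induction p rule: laurent_induct)
  note T = ideal_torus[of \<alpha> \<beta> \<gamma>, unfolded ideal_laurent_iff]
  note V = closed_diff_supported[of "cells \<alpha> \<beta>"]
  case zero
  show ?case using T closed_diffD(1)[OF V] by force
next
  note T = ideal_torus[of \<alpha> \<beta> \<gamma>, unfolded ideal_laurent_iff]
  note V = closed_diff_supported[of "cells \<alpha> \<beta>"]
  case (add p n m)
  then obtain r where r: "r \<in> supported (cells \<alpha> \<beta>)" "p + r \<in> torus_ideal \<alpha> \<beta> \<gamma>" by blast
  obtain d where d: "d \<in> cells \<alpha> \<beta>" "(n, m) - d \<in> torus_lattice \<alpha> \<beta> \<gamma>"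
    using cells_exists[OF assms] by blast
  have "xy (n - fst d) (m - snd d) + 1 \<in> torus_ideal \<alpha> \<beta> \<gamma>"
    using d(2) by (intro xy_lattice_torus) (cases d, simp)
  then have "xy (fst d) (snd d) * (xy (n - fst d) (m - snd d) + 1) \<in> torus_ideal \<alpha> \<beta> \<gamma>"
    using T by blast
  then have "xy n m + xy (fst d) (snd d) \<in> torus_ideal \<alpha> \<beta> \<gamma>"
    by (simp add: distrib_left xy_mult_xy)
  then have "(xy n m + xy (fst d) (snd d)) + (p + r) \<in> torus_ideal \<alpha> \<beta> \<gamma>"
    using T r(2) by blast
  moreover have "xy (fst d) (snd d) + r \<in> supported (cells \<alpha> \<beta>)"
    using d(1) r(1) by (intro closed_diffD(3)[OF V]) (auto simp: supported_def xy_def)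
  ultimately show ?case by (intro bexI[of _ "xy (fst d) (snd d) + r"]) (simp_all add: ac_simps)
qed

text \<open>The elements all of whose multiples have trace zero form an ideal. It contains both
  generators, because the trace is invariant under lattice translations.\<close>

lemma torus_ideal_trace_zero:
  assumes "p \<in> torus_ideal \<alpha> \<beta> \<gamma>"
  shows "trace (torus_lattice \<alpha> \<beta> \<gamma>) (p * q) = 0"
proof -
  define L where "L = torus_lattice \<alpha> \<beta> \<gamma>"
  have L: "closed_diff L" unfolding L_def by (rule closed_diff_lattice)
  define T' where "T' = {p. \<forall>q. trace L (p * q) = 0}"
  have "ideal T' laurent_ring"
    unfolding ideal_laurent_iff T'_def by (auto simp: trace_0 distrib_right trace_add mult.assoc mult.left_commute)
  moreover have "xy n m - 1 \<in> T'" if "(n, m) \<in> L" for n m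
    using trace_lattice_mult[OF L that] by (auto simp: T'_def distrib_right trace_add)
  then have "{xy 0 (int \<alpha>) - 1, xy (int \<beta>) \<gamma> - 1} \<subseteq> T'"
    unfolding L_def torus_lattice_def by (force intro: exI[of _ 0] exI[of _ 1])
  ultimately have "torus_ideal \<alpha> \<beta> \<gamma> \<subseteq> T'"
    unfolding torus_ideal_def by (rule ring.genideal_minimal[OF cring.axioms(1)[OF cring_class]])
  then show ?thesis using assms by (auto simp: T'_def L_def)
qed

text \<open>Translating a cell of the support to the origin isolates it: no other cell of the
  fundamental domain is congruent to it, so the trace becomes 1.\<close>

lemma supported_cells_trace_nondegenerate:
  assumes "r \<in> supported (cells \<alpha> \<beta>)" "r \<noteq> 0"
  shows "\<exists>n m. trace (torus_lattice \<alpha> \<beta> \<gamma>) (xy n m * r) \<noteq> 0"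
proof -
  obtain d where d: "d \<in> keys r" using assms(2) by (metis ex_in_conv keys_eq_empty)
  have "(- fst d, - snd d) + c \<in> torus_lattice \<alpha> \<beta> \<gamma> \<longleftrightarrow> c = d" if "c \<in> keys r" for c
  proof -
    have "(- fst d, - snd d) + c = c - d" by (simp add: prod_eq_iff)
    moreover have "c - d \<in> torus_lattice \<alpha> \<beta> \<gamma> \<longleftrightarrow> c = d"
      using cells_unique[of c \<alpha> \<beta> d] that d assms(1) closed_diffD(1)[OF closed_diff_lattice]
      by (auto simp: supported_def)
    ultimately show ?thesis by simp
  qed
  then have "trace (torus_lattice \<alpha> \<beta> \<gamma>) (xy (- fst d) (- snd d) * r) = (\<Sum>c\<in>keys r. of_bool (c = d))"
    unfolding trace_xy_mult by (intro sum.cong) auto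
  also have "\<dots> = 1" using d by (simp add: of_bool_def)
  finally show ?thesis by (metis zero_neq_one)
qed

text \<open>For the converse, the normal form of \<open>p\<close> is again orthogonal to all
  monomials, so nondegeneracy makes it zero.\<close>

lemma torus_ideal_iff_trace:
  assumes "\<alpha> \<ge> 1" "\<beta> \<ge> 1"
  shows "p \<in> torus_ideal \<alpha> \<beta> \<gamma> \<longleftrightarrow> (\<forall>q. trace (torus_lattice \<alpha> \<beta> \<gamma>) (p * q) = 0)"
proof (intro iffI allI)
  show "trace (torus_lattice \<alpha> \<beta> \<gamma>) (p * q) = 0" if "p \<in> torus_ideal \<alpha> \<beta> \<gamma>" for q
    using that by (rule torus_ideal_trace_zero)
next
  assume p: "\<forall>q. trace (torus_lattice \<alpha> \<beta> \<gamma>) (p * q) = 0"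
  obtain r where r: "r \<in> supported (cells \<alpha> \<beta>)" "p + r \<in> torus_ideal \<alpha> \<beta> \<gamma>"
    using torus_normal_form[OF assms] by blast
  have "trace (torus_lattice \<alpha> \<beta> \<gamma>) (xy n m * r) = 0" for n m
    using torus_ideal_trace_zero[OF r(2), of "xy n m"] p
    unfolding distrib_right trace_add by (simp add: mult.commute[of r])
  then have "r = 0" using supported_cells_trace_nondegenerate[OF r(1)] by blast
  then show "p \<in> torus_ideal \<alpha> \<beta> \<gamma>" using r(2) by simp
qed

text \<open>The lattice is symmetric under negation, so the antipode preserves the trace and with it
  the radical of the trace form.\<close>

lemma antipode_torus_iff:
  assumes "\<alpha> \<ge> 1" "\<beta> \<ge> 1"
  shows "antipode p \<in> torus_ideal \<alpha> \<beta> \<gamma> \<longleftrightarrow> p \<in> torus_ideal \<alpha> \<beta> \<gamma>"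
proof -
  have "antipode p \<in> torus_ideal \<alpha> \<beta> \<gamma>" if "p \<in> torus_ideal \<alpha> \<beta> \<gamma>" for p
  proof -
    have "trace (torus_lattice \<alpha> \<beta> \<gamma>) (antipode p * q) = trace (torus_lattice \<alpha> \<beta> \<gamma>) (p * antipode q)" for q
      using trace_antipode[OF closed_diff_lattice, of \<alpha> \<beta> \<gamma> "p * antipode q"] by (simp add: antipode_mult)
    then show ?thesis using that by (simp add: torus_ideal_iff_trace[OF assms])
  qed
  from this[of p] this[of "antipode p"] show ?thesis by auto
qed

section \<open>The logical dimension\<close>

lemma RDirProd_simps:
  "\<zero>\<^bsub>RDirProd R S\<^esub> = (\<zero>\<^bsub>R\<^esub>, \<zero>\<^bsub>S\<^esub>)" "\<one>\<^bsub>RDirProd R S\<^esub> = (\<one>\<^bsub>R\<^esub>, \<one>\<^bsub>S\<^esub>)"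
  "(a, b) \<oplus>\<^bsub>RDirProd R S\<^esub> (c, d) = (a \<oplus>\<^bsub>R\<^esub> c, b \<oplus>\<^bsub>S\<^esub> d)"
  by (simp_all add: RDirProd_def DirProd_def monoid.defs)

abbreviation coset :: "laurent set \<Rightarrow> laurent \<Rightarrow> laurent set"
  where "coset J p \<equiv> J +>\<^bsub>laurent_ring\<^esub> p"

lemma coset_laurent_eq_iff:
  assumes "ideal J laurent_ring"
  shows "coset J p = coset J q \<longleftrightarrow> p + q \<in> J"
  using coset_class_eq_iff[of J p q] assms by (simp add: ideal_class_iff)

text \<open>For an ideal \<open>T\<close>, the sum of \<open>T\<close> and the ideal generated by
  \<open>p\<close> and \<open>q\<close>; in characteristic two \<open>+\<close> also serves as
  minus.\<close>

definition extend_ideal :: "laurent set \<Rightarrow> laurent \<Rightarrow> laurent \<Rightarrow> laurent set"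
  where "extend_ideal T p q = {x. \<exists>a b. x + (a * p + b * q) \<in> T}"

lemma ideal_extend_ideal:
  assumes "ideal T laurent_ring"
  shows "ideal (extend_ideal T p q) laurent_ring"
proof -
  note T = assms[unfolded ideal_laurent_iff]
  have "x + y \<in> extend_ideal T p q" if xy: "x \<in> extend_ideal T p q" "y \<in> extend_ideal T p q" for x y
  proof -
    obtain a b c d where *: "x + (a * p + b * q) \<in> T" "y + (c * p + d * q) \<in> T"
      using xy unfolding extend_ideal_def by blast
    have "(x + y) + ((a + c) * p + (b + d) * q) = (x + (a * p + b * q)) + (y + (c * p + d * q))"
      by (simp add: distrib_right add_ac)
    then show ?thesis using * T unfolding extend_ideal_def mem_Collect_eq by metis
  qed
  moreover have "r * x \<in> extend_ideal T p q" if x: "x \<in> extend_ideal T p q" for r x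
  proof -
    obtain a b where *: "x + (a * p + b * q) \<in> T"
      using x unfolding extend_ideal_def by blast
    have "r * x + ((r * a) * p + (r * b) * q) = r * (x + (a * p + b * q))"
      by (simp add: distrib_left mult.assoc)
    then show ?thesis using * T unfolding extend_ideal_def mem_Collect_eq by metis
  qed
  moreover have "0 \<in> extend_ideal T p q"
    using T unfolding extend_ideal_def by (auto intro!: exI[of _ 0])
  ultimately show ?thesis unfolding ideal_laurent_iff by blast
qed

text \<open>Since the trace form is nondegenerate, the annihilator of \<open>p\<close> and \<open>q\<close> in the torus ring is the
  orthogonal complement of the ideal that they generate. The stabilizer space is the quotient by that
  annihilator, so it has the size of the ideal.\<close>

lemma index_mult_stabilizer_space:
  fixes p q :: laurent and \<gamma> :: int
  assumes ab: "\<alpha> \<ge> 1" "\<beta> \<ge> 1"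
  defines "S \<equiv> torus_ring \<alpha> \<beta> \<gamma>"
  shows "ideal_index (extend_ideal (torus_ideal \<alpha> \<beta> \<gamma>) p q)
    * 2 ^ dim2 (RDirProd S S) (stabilizer_space \<alpha> \<beta> \<gamma> p q) = 2 ^ (\<alpha> * \<beta>)"
proof -
  define T where "T = torus_ideal \<alpha> \<beta> \<gamma>"
  define V where "V = supported (cells \<alpha> \<beta>)"
  define L where "L = torus_lattice \<alpha> \<beta> \<gamma>"
  define K where "K = extend_ideal T p q"
  define \<phi> where "\<phi> r = (coset T (r * p), coset T (r * q))" for r
  have idT: "ideal T laurent_ring" unfolding T_def by (rule ideal_torus)
  note T = idT[unfolded ideal_laurent_iff]
  have idK: "ideal K laurent_ring" unfolding K_def by (rule ideal_extend_ideal[OF idT])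
  note K = idK[unfolded ideal_laurent_iff]
  have T_iff: "x \<in> T \<longleftrightarrow> (\<forall>y. trace L (x * y) = 0)" for x
    unfolding T_def L_def by (rule torus_ideal_iff_trace[OF ab])
  have normal: "\<exists>r\<in>V. x + r \<in> T" for x
    unfolding T_def V_def by (rule torus_normal_form[OF ab])
  have V: "finite V" "closed_diff V" "card V = 2 ^ (\<alpha> * \<beta>)"
    unfolding V_def using card_supported card_cells closed_diff_supported by auto
  have TK: "x \<in> K" if "x \<in> T" for x
    using that unfolding K_def extend_ideal_def by (auto intro!: exI[of _ 0])
  note Q = Quot_class_simps[OF idT, folded torus_ring_def[of \<alpha> \<beta> \<gamma>, folded T_def S_def]]
  \<comment> \<open>\<open>\<phi>\<close> depends only on the class modulo \<open>T\<close>, so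
    representatives in \<open>V\<close> suffice.\<close>
  have space: "stabilizer_space \<alpha> \<beta> \<gamma> p q = \<phi> ` V"
  proof -
    have "stabilizer_space \<alpha> \<beta> \<gamma> p q = range \<phi>"
      unfolding stabilizer_space_def T_def[symmetric] S_def[symmetric]
      by (simp add: Setcompr_eq_image image_image Q \<phi>_def)
    also have "range \<phi> = \<phi> ` V"
    proof -
      have "\<phi> x \<in> \<phi> ` V" for x
      proof -
        obtain r where r: "r \<in> V" "x + r \<in> T" using normal by blast
        have "p * (x + r) \<in> T" "q * (x + r) \<in> T" using T r(2) by blast+
        then have "\<phi> x = \<phi> r"
          unfolding \<phi>_def by (simp add: coset_laurent_eq_iff[OF idT] distrib_left mult.commute)
        then show ?thesis using r(1) by simp
      qed
      then show ?thesis by auto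
    qed
    finally show ?thesis .
  qed
  define A where "A = {r. r * p \<in> T \<and> r * q \<in> T}"
  have 1: "card (\<phi> ` V) * card (V \<inter> A) = card V"
    by (rule card_image_mult_kernel[OF V(1,2)])
       (simp add: \<phi>_def coset_laurent_eq_iff[OF idT] A_def distrib_right)
  \<comment> \<open>\<open>V\<close> represents the torus ring and \<open>V \<inter> K\<close> its
    ideal generated by \<open>p\<close> and \<open>q\<close>, paired by the trace form.\<close>
  have 2: "card (V \<inter> K) * card {v \<in> V. \<forall>j\<in>V \<inter> K. trace L (v * j) = 0} = card V"
  proof (rule card_orthogonal[OF V(1,2)])
    show "closed_diff (V \<inter> K)"
      using V(2) K by (simp add: closed_diff_def)
    show "\<exists>v\<in>V. trace L (v * j) \<noteq> 0" if j: "j \<in> V \<inter> K" "j \<noteq> 0" for j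
    proof -
      obtain n m where nm: "trace L (xy n m * j) \<noteq> 0"
        using supported_cells_trace_nondegenerate[of j] j unfolding V_def L_def by blast
      obtain r where r: "r \<in> V" "xy n m + r \<in> T" using normal by blast
      have "trace L (xy n m * j) + trace L (r * j) = 0"
        using T_iff r(2) by (simp flip: trace_add distrib_right)
      then have "trace L (r * j) \<noteq> 0" using nm by (metis add.right_neutral)
      then show ?thesis using r(1) by blast
    qed
  qed (auto simp: distrib_left distrib_right trace_add)
  \<comment> \<open>Orthogonality to \<open>V \<inter> K\<close> extends to \<open>K\<close> by
    normal forms. Since \<open>K\<close> contains all multiples of \<open>p\<close> and
    \<open>q\<close>, this puts \<open>v * p\<close> and \<open>v * q\<close> into the radical
    \<open>T\<close>.\<close>
  have "{v \<in> V. \<forall>j\<in>V \<inter> K. trace L (v * j) = 0} = V \<inter> A"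
  proof -
    have "v \<in> A" if v: "\<forall>j\<in>V \<inter> K. trace L (v * j) = 0" for v
    proof -
      have "trace L (v * x) = 0" if x: "x \<in> K" for x
      proof -
        obtain r where r: "r \<in> V" "x + r \<in> T" using normal by blast
        have "x + (x + r) \<in> K" using K x TK[OF r(2)] by blast
        then have "r \<in> K" by (simp add: laurent_add_cancel)
        then have "trace L (v * r) = 0" using v r(1) by blast
        moreover have "trace L (v * x) + trace L (v * r) = 0"
          using T_iff r(2) by (simp add: mult.commute[of v] flip: trace_add distrib_right)
        ultimately show ?thesis by simp
      qed
      moreover have "p * y \<in> K" "q * y \<in> K" for y
        unfolding K_def extend_ideal_def mem_Collect_eq
        by (rule exI[of _ y], rule exI[of _ 0], use T in \<open>simp add: mult.commute\<close>)
           (rule exI[of _ 0], rule exI[of _ y], use T in \<open>simp add: mult.commute\<close>)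
      ultimately show "v \<in> A" unfolding A_def T_iff by (simp add: mult.assoc)
    qed
    moreover have "trace L (v * j) = 0" if v: "v \<in> A" and j: "j \<in> K" for v j
    proof -
      obtain a b where ab: "j + (a * p + b * q) \<in> T"
        using j unfolding K_def extend_ideal_def by blast
      have "v * (j + (a * p + b * q)) \<in> T" "a * (v * p) \<in> T" "b * (v * q) \<in> T"
        using T ab v by (auto simp: A_def)
      then have "v * (j + (a * p + b * q)) + (a * (v * p) + b * (v * q)) \<in> T"
        using T by blast
      also have "v * (j + (a * p + b * q)) + (a * (v * p) + b * (v * q))
          = (v * (a * p + b * q)) + (v * (a * p + b * q) + v * j)"
        by (simp add: distrib_left ac_simps)
      finally have "v * j \<in> T" by (simp only: laurent_add_cancel)
      then show ?thesis using T_iff[of "v * j"] by (metis mult.right_neutral)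
    qed
    ultimately show ?thesis by blast
  qed
  with 1 2 have "card (\<phi> ` V) * card (V \<inter> A) = card (V \<inter> K) * card (V \<inter> A)" by simp
  moreover have "card (\<phi> ` V) * card (V \<inter> A) \<noteq> 0" unfolding 1 V(3) by simp
  ultimately have card_eq: "card (\<phi> ` V) = card (V \<inter> K)" by simp
  \<comment> \<open>With \<open>card_eq\<close>, the index of \<open>K\<close> and the size of the
    stabilizer space then multiply to \<open>card V\<close>.\<close>
  have 3: "card (coset K ` V) * card (V \<inter> K) = card V"
    by (rule card_image_mult_kernel[OF V(1,2)]) (simp add: coset_laurent_eq_iff[OF idK])
  have "range (coset K) = coset K ` V"
  proof -
    have "coset K x \<in> coset K ` V" for x
    proof -
      obtain r where "r \<in> V" "x + r \<in> T" using normal by blast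
      then have "r \<in> V" "coset K x = coset K r" by (simp_all add: coset_laurent_eq_iff[OF idK] TK)
      then show ?thesis by blast
    qed
    then show ?thesis by blast
  qed
  with 3 card_eq have "ideal_index K * card (\<phi> ` V) = 2 ^ (\<alpha> * \<beta>)"
    by (simp add: ideal_index_def V(3))
  moreover have "card (\<phi> ` V) = 2 ^ dim2 (RDirProd S S) (\<phi> ` V)"
  proof (rule card_eq_power_dim2)
    show "ring (RDirProd S S)" by (rule RDirProd_ring) (rule Q)+
    show "\<one>\<^bsub>RDirProd S S\<^esub> \<oplus>\<^bsub>RDirProd S S\<^esub> \<one>\<^bsub>RDirProd S S\<^esub> = \<zero>\<^bsub>RDirProd S S\<^esub>"
      by (simp add: RDirProd_simps Q)
    show "\<phi> ` V \<subseteq> carrier (RDirProd S S)"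
      by (auto simp: RDirProd_carrier Q \<phi>_def)
    show "finite (\<phi> ` V)" using V(1) by simp
    show "\<zero>\<^bsub>RDirProd S S\<^esub> \<in> \<phi> ` V"
      using closed_diffD(1)[OF V(2)] by (auto simp: RDirProd_simps Q \<phi>_def intro!: image_eqI[of _ _ 0])
    show "a \<oplus>\<^bsub>RDirProd S S\<^esub> b \<in> \<phi> ` V" if ab: "a \<in> \<phi> ` V" "b \<in> \<phi> ` V" for a b
    proof -
      obtain r s where rs: "a = \<phi> r" "b = \<phi> s" "r \<in> V" "s \<in> V" using ab by blast
      then have "a \<oplus>\<^bsub>RDirProd S S\<^esub> b = \<phi> (r + s)"
        by (simp add: \<phi>_def RDirProd_simps Q distrib_right)
      then show ?thesis using closed_diffD(3)[OF V(2) rs(3,4)] by simp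
    qed
  qed
  ultimately show ?thesis unfolding space K_def T_def by simp
qed

text \<open>The antipode is an additive involution, so it carries the cosets of \<open>J\<close>
  bijectively to those of \<open>J'\<close>.\<close>

lemma ideal_index_antipode:
  assumes "\<And>x. antipode x \<in> J' \<longleftrightarrow> x \<in> J"
  shows "ideal_index J' = ideal_index J"
proof -
  have mem: "x \<in> antipode ` A \<longleftrightarrow> antipode x \<in> A" for x A
    by (metis antipode_antipode image_iff)
  have "coset J' (antipode p) = antipode ` coset J p" for p
  proof (rule Set.set_eqI)
    fix x
    have "x + antipode p \<in> J' \<longleftrightarrow> antipode x + p \<in> J"
      using assms[of "antipode x + p"] by (simp add: antipode_add)
    then show "x \<in> coset J' (antipode p) \<longleftrightarrow> x \<in> antipode ` coset J p"
      unfolding mem by (simp add: coset_class)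
  qed
  moreover have "range (coset J') = (\<lambda>p. coset J' (antipode p)) ` UNIV"
  proof -
    have "range antipode = UNIV" by (rule surjI[of _ antipode]) simp
    then show ?thesis by (metis image_image)
  qed
  ultimately have "range (coset J') = (`) antipode ` range (coset J)"
    by (simp add: image_image)
  moreover have "inj antipode" by (metis antipode_antipode injI)
  from inj_on_image_Pow[OF this] have "inj_on ((`) antipode) (range (coset J))"
    by (rule inj_on_subset) simp
  ultimately show ?thesis
    unfolding ideal_index_def by (simp add: card_image)
qed

text \<open>The torus ideal is stable under the antipode, and exchanging \<open>f\<close> and
  \<open>g\<close> only exchanges the coefficients \<open>a\<close> and \<open>b\<close>.\<close>

lemma extend_ideal_antipode:
  assumes "\<alpha> \<ge> 1" "\<beta> \<ge> 1"
  shows "antipode x \<in> extend_ideal (torus_ideal \<alpha> \<beta> \<gamma>) (antipode g) (antipode f)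
    \<longleftrightarrow> x \<in> extend_ideal (torus_ideal \<alpha> \<beta> \<gamma>) f g"
proof
  assume "x \<in> extend_ideal (torus_ideal \<alpha> \<beta> \<gamma>) f g"
  then obtain a b where "x + (a * f + b * g) \<in> torus_ideal \<alpha> \<beta> \<gamma>"
    by (auto simp: extend_ideal_def)
  then have "antipode (x + (b * g + a * f)) \<in> torus_ideal \<alpha> \<beta> \<gamma>"
    by (simp add: antipode_torus_iff[OF assms] add.commute)
  then show "antipode x \<in> extend_ideal (torus_ideal \<alpha> \<beta> \<gamma>) (antipode g) (antipode f)"
    unfolding extend_ideal_def antipode_add antipode_mult by blast
next
  assume "antipode x \<in> extend_ideal (torus_ideal \<alpha> \<beta> \<gamma>) (antipode g) (antipode f)"
  then obtain a b where "antipode x + (a * antipode g + b * antipode f) \<in> torus_ideal \<alpha> \<beta> \<gamma>"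
    by (auto simp: extend_ideal_def)
  then have "antipode (antipode x + (b * antipode f + a * antipode g)) \<in> torus_ideal \<alpha> \<beta> \<gamma>"
    by (simp add: antipode_torus_iff[OF assms] add.commute)
  then show "x \<in> extend_ideal (torus_ideal \<alpha> \<beta> \<gamma>) f g"
    unfolding extend_ideal_def antipode_add antipode_mult antipode_antipode by blast
qed

text \<open>The antipode matches the ideals of the two types, which therefore have equal index, so
  both stabilizer spaces have the same dimension \<open>d\<close>; the exponent is
  \<open>k = \<alpha> * \<beta> - d\<close>.\<close>

lemma logical_dim_eq:
  assumes "\<alpha> \<ge> 1" "\<beta> \<ge> 1"
  shows "\<exists>k. ideal_index (extend_ideal (torus_ideal \<alpha> \<beta> \<gamma>) f g) = 2 ^ k \<and> logical_dim f g \<alpha> \<beta> \<gamma> = 2 * int k"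
proof -
  define S2 where "S2 = RDirProd (torus_ring \<alpha> \<beta> \<gamma>) (torus_ring \<alpha> \<beta> \<gamma>)"
  define N where "N = ideal_index (extend_ideal (torus_ideal \<alpha> \<beta> \<gamma>) f g)"
  define d where "d = dim2 S2 (stabilizer_space \<alpha> \<beta> \<gamma> f g)"
  define d' where "d' = dim2 S2 (stabilizer_space \<alpha> \<beta> \<gamma> (antipode g) (antipode f))"
  have Nd: "N * 2 ^ d = 2 ^ (\<alpha> * \<beta>)"
    unfolding N_def d_def S2_def by (rule index_mult_stabilizer_space[OF assms])
  have "ideal_index (extend_ideal (torus_ideal \<alpha> \<beta> \<gamma>) (antipode g) (antipode f)) = N"
    unfolding N_def by (intro ideal_index_antipode extend_ideal_antipode assms)
  then have "N * 2 ^ d' = 2 ^ (\<alpha> * \<beta>)"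
    unfolding d'_def S2_def using index_mult_stabilizer_space[OF assms] by metis
  then have "N * 2 ^ d' = N * 2 ^ d" "N \<noteq> 0" using Nd by (auto intro: ccontr)
  then have "d' = d" by simp
  have "(2 :: nat) ^ d \<le> 2 ^ (\<alpha> * \<beta>)" using Nd \<open>N \<noteq> 0\<close> by (metis dvd_imp_le dvd_triv_right zero_less_numeral zero_less_power)
  then have le: "d \<le> \<alpha> * \<beta>" by simp
  then have "N * 2 ^ d = 2 ^ (\<alpha> * \<beta> - d) * 2 ^ d"
    unfolding Nd by (simp flip: power_add)
  then have "N = 2 ^ (\<alpha> * \<beta> - d)" by simp
  moreover have "logical_dim f g \<alpha> \<beta> \<gamma> = 2 * int (\<alpha> * \<beta> - d)"
    unfolding logical_dim_def Let_def S2_def[symmetric] d_def[symmetric] d'_def[symmetric] \<open>d' = d\<close>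
    using le by (simp add: of_nat_diff)
  ultimately show ?thesis unfolding N_def by blast
qed

text \<open>A coset of \<open>I\<close> lies in a single coset of \<open>K\<close>, which gives a
  surjection of quotients. Finiteness matters because \<open>card\<close> is 0 on infinite
  sets.\<close>

lemma ideal_index_antimono:
  assumes "ideal I laurent_ring" "ideal K laurent_ring" "I \<subseteq> K" "finite (range (coset I))"
  shows "ideal_index K \<le> ideal_index I"
proof -
  \<comment> \<open>This writes the surjection as a function of the bare set: all elements of a
    coset of \<open>I\<close> yield the same coset of \<open>K\<close>.\<close>
  have union: "coset K p = (\<Union>x\<in>coset I p. coset K x)" for p
  proof -
    have "p \<in> coset I p" using assms(1) by (simp add: coset_class ideal_laurent_iff)
    moreover have "coset K x = coset K p" if "x \<in> coset I p" for x
      using that assms(3) by (auto simp: coset_class[of I] coset_laurent_eq_iff[OF assms(2)])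
    ultimately show ?thesis by blast
  qed
  have "range (coset K) = (\<lambda>X. \<Union>x\<in>X. coset K x) ` range (coset I)"
    unfolding image_image by (rule image_cong[OF refl union])
  then show ?thesis unfolding ideal_index_def using card_image_le[OF assms(4)] by metis
qed

text \<open>Pigeonhole: two powers of the monomial agree modulo \<open>I\<close>, and the smaller
  one can be divided out because monomials are units.\<close>

lemma monomial_period:
  assumes "ideal I laurent_ring" "finite (range (coset I))"
  shows "\<exists>k\<ge>1. xy (n * int k) (m * int k) - 1 \<in> I"
proof -
  have "finite (range (\<lambda>i::nat. coset I (xy (n * int i) (m * int i))))"
    using assms(2) by (rule finite_subset[rotated]) auto
  then have "\<not> inj (\<lambda>i::nat. coset I (xy (n * int i) (m * int i)))"
    using finite_imageD infinite_UNIV_nat by blast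
  then obtain i j :: nat where "coset I (xy (n * int i) (m * int i)) = coset I (xy (n * int j) (m * int j))" "i < j"
    unfolding inj_on_def by (metis linorder_neqE_nat)
  then have "xy (n * int i) (m * int i) + xy (n * int j) (m * int j) \<in> I" "i < j"
    by (simp_all add: coset_laurent_eq_iff[OF assms(1)])
  then have "xy (- n * int i) (- m * int i) * (xy (n * int i) (m * int i) + xy (n * int j) (m * int j)) \<in> I"
    using assms(1) unfolding ideal_laurent_iff by blast
  also have "xy (- n * int i) (- m * int i) * (xy (n * int i) (m * int i) + xy (n * int j) (m * int j))
      = xy (n * int (j - i)) (m * int (j - i)) - 1"
    using \<open>i < j\<close> by (simp add: distrib_left xy_mult_xy xy_0_0 of_nat_diff right_diff_distrib add.commute)
  finally show ?thesis using \<open>i < j\<close> by (intro exI[of _ "j - i"]) simp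
qed

theorem theorem1:
  fixes f g :: laurent
  assumes "topological_order f g"
  shows "let Q = laurent_ring Quot (Idl\<^bsub>laurent_ring\<^esub> {f, g})
         in fin_dim2 Q (carrier Q) \<and>
            is_max_logical_dim f g (2 * int (dim2 Q (carrier Q)))"
proof -
  define I where "I = Idl\<^bsub>laurent_ring\<^esub> {f, g}"
  define Q where "Q = laurent_ring Quot I"
  have idI: "ideal I laurent_ring" unfolding I_def by (rule ideal_genideal_class)
  note I = idI[unfolded ideal_laurent_iff]
  have fg: "f \<in> I" "g \<in> I" unfolding I_def by (auto intro: genideal_class_self)
  then have comb: "a * f + b * g \<in> I" for a b using I by blast
  have fin: "finite (range (coset I))"
    using finite_cosets_of_exact[OF topological_order_exact[OF assms] idI fg] .
  note QI = Quot_class_simps[OF idI, folded Q_def]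
  have Q: "fin_dim2 Q (carrier Q)" "card (carrier Q) = 2 ^ dim2 Q (carrier Q)"
    using card_eq_power_dim2[of Q "carrier Q"] QI fin
      ring.ring_simprules(1,2)[OF QI(1)] by auto
  define D where "D = dim2 Q (carrier Q)"
  have index_I: "ideal_index I = 2 ^ D" using Q(2) by (simp add: ideal_index_def D_def QI)
  \<comment> \<open>On every torus \<open>K\<close> contains \<open>f\<close> and \<open>g\<close>,
    hence \<open>I\<close>, so it has at most as many residue classes.\<close>
  have upper: "logical_dim f g \<alpha> \<beta> \<gamma> \<le> 2 * int D" if ab: "\<alpha> \<ge> 1" "\<beta> \<ge> 1" for \<alpha> \<beta> \<gamma>
  proof -
    define K where "K = extend_ideal (torus_ideal \<alpha> \<beta> \<gamma>) f g"
    obtain k where k: "ideal_index K = 2 ^ k" "logical_dim f g \<alpha> \<beta> \<gamma> = 2 * int k"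
      using logical_dim_eq[OF ab] unfolding K_def by blast
    have idK: "ideal K laurent_ring" unfolding K_def by (intro ideal_extend_ideal ideal_torus)
    have "f + (1 * f + 0 * g) \<in> torus_ideal \<alpha> \<beta> \<gamma>" "g + (0 * f + 1 * g) \<in> torus_ideal \<alpha> \<beta> \<gamma>"
      using ideal_torus[of \<alpha> \<beta> \<gamma>] unfolding ideal_laurent_iff by simp_all
    then have "{f, g} \<subseteq> K" unfolding K_def extend_ideal_def by blast
    then have "I \<subseteq> K"
      unfolding I_def by (rule ring.genideal_minimal[OF cring.axioms(1)[OF cring_class] idK])
    then have "2 ^ k \<le> (2 :: nat) ^ D"
      using ideal_index_antimono[OF idI idK _ fin] k(1) index_I by simp
    then show ?thesis using k(2) by simp
  qed
  \<comment> \<open>Exponents at which powers of \<open>y\<close> and \<open>x\<close> become 1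
    modulo \<open>I\<close> serve as sides of an untwisted torus, which puts its torus ideal inside
    \<open>I\<close>.\<close>
  obtain \<alpha> where \<alpha>: "\<alpha> \<ge> 1" "xy 0 (int \<alpha>) - 1 \<in> I"
    using monomial_period[OF idI fin, of 0 1] by auto
  obtain \<beta> where \<beta>: "\<beta> \<ge> 1" "xy (int \<beta>) 0 - 1 \<in> I"
    using monomial_period[OF idI fin, of 1 0] by auto
  have "{xy 0 (int \<alpha>) - 1, xy (int \<beta>) 0 - 1} \<subseteq> I" using \<alpha> \<beta> by blast
  then have TI: "torus_ideal \<alpha> \<beta> 0 \<subseteq> I"
    unfolding torus_ideal_def by (rule ring.genideal_minimal[OF cring.axioms(1)[OF cring_class] idI])
  define K where "K = extend_ideal (torus_ideal \<alpha> \<beta> 0) f g"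
  have idK: "ideal K laurent_ring" unfolding K_def by (intro ideal_extend_ideal ideal_torus)
  have "x \<in> I" if x: "x \<in> K" for x
  proof -
    obtain a b where "x + (a * f + b * g) \<in> I" using x TI unfolding K_def extend_ideal_def by blast
    then have "(a * f + b * g) + (x + (a * f + b * g)) \<in> I" using comb I by blast
    then show ?thesis by (simp only: laurent_add_cancel)
  qed
  then have KI: "K \<subseteq> I" by blast
  obtain k where k: "ideal_index K = 2 ^ k" "logical_dim f g \<alpha> \<beta> 0 = 2 * int k"
    using logical_dim_eq[OF \<alpha>(1) \<beta>(1)] unfolding K_def by blast
  \<comment> \<open>The index is a power of 2, hence nonzero, whereas an infinite set has
    \<open>card\<close> 0.\<close>
  have "finite (range (coset K))"
    using k(1) unfolding ideal_index_def by (intro card_ge_0_finite) simp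
  then have "2 ^ D \<le> (2 :: nat) ^ k"
    using ideal_index_antimono[OF idK idI KI] k(1) index_I by simp
  then have "logical_dim f g \<alpha> \<beta> 0 = 2 * int D"
    using k(2) upper[OF \<alpha>(1) \<beta>(1), of 0] by simp
  then have "is_max_logical_dim f g (2 * int D)"
    unfolding is_max_logical_dim_def using \<alpha>(1) \<beta>(1) upper by blast
  then show ?thesis using Q(1) unfolding Let_def Q_def I_def D_def by blast
qed

end
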